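(* Let $n_1,n_2,n_3$ be positive integers with $\frac{\pi}{n_1}+\frac{\pi}{n_2}+\frac{\pi}{n_3}<\pi$, and let $\mathcal{T}\subset\mathbb{H}$ be a geodesic triangle in the hyperbolic plane with angles $\frac{\pi}{n_1},\frac{\pi}{n_2},\frac{\pi}{n_3}$. Let $R_1,R_2,R_3$ be the reflections with respect to the sides of $\mathcal{T}$, let $\Lambda$ be the group of transformations of $\mathbb{H}$ generated by $R_1,R_2,R_3$, and let $\Lambda_0\subset\Lambda$ be the subgroup of elements which are products of an even number of these reflections. Let $$\Gamma=\{g\in\mathrm{SL}_2(\mathbb{R}):\ T_g\in\Lambda_0\}.$$ Then $\Gamma$ is a cocompact lattice in $\mathrm{SL}_2(\mathbb{R})$.
   Context: $\mathbb{H}=\{x+iy:x\in\mathbb{R},y>0\}$ is the upper half plane, where the hyperbolic length of a $C^1$ curve $c:[0,1]\to\mathbb{H}$ is $L(c)=\int_0^1\frac{\|c'(t)\|}{\mathrm{Im}(c(t))}\,dt$; its geodesics are vertical lines and semicircles centred on the real axis. For $g=\begin{pmatrix}a&b\\c&d\end{pmatrix}\in\mathrm{SL}_2(\mathbb{R})$, $T_g:\mathbb{H}\to\mathbb{H}$, $T_g(z)=\frac{az+b}{cz+d}$. If $\ell_0$ is the imaginary half-axis, the reflection is $R_{\ell_0}(z)=-\bar z$; for a general geodesic $\ell$, $R_\ell=T_g^{-1}R_{\ell_0}T_g$ where $g\in\mathrm{SL}_2(\mathbb{R})$ satisfies $T_g(\ell)=\ell_0$. The side of a triangle determines a geodesic,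 and the reflection with respect to the side means the reflection in this geodesic. A discrete subgroup $\Gamma$ of a Lie group $G$ is a lattice if $\Gamma\backslash G$ has finite measure with respect to the measure induced from the left-invariant (Haar) measure $m$ on $G$ (i.e. $m(F)<\infty$ for a Borel fundamental set $F$, meaning $G=\bigsqcup_{\gamma\in\Gamma}\gamma F$); it is cocompact if $\Gamma\backslash G$ is compact. *)

theory Defs
  imports
    "HOL-Analysis.Analysis"
    "HOL-Algebra.Bij"
    "HOL-Algebra.Coset"
    "HOL-Algebra.Generated_Groups"
begin

section \<open>Lattices in topological groups\<close>

text \<open>A topological group is given by a group \<open>G\<close> together with a topology \<open>X\<close> on its carrier.\<close>

definition discrete_subgroup ::
    "('a, 'b) monoid_scheme \<Rightarrow> 'a topology \<Rightarrow> 'a set \<Rightarrow> bool" where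
  "discrete_subgroup G X H \<longleftrightarrow> subgroup H G \<and> subtopology X H = discrete_topology H"

text \<open>Left Haar measures: nonzero left-invariant Borel measures that are finite on compact sets.
  On the second countable locally compact groups considered here (Lie groups) such measures are
  automatically regular.\<close>

definition left_haar_measure ::
    "('a, 'b) monoid_scheme \<Rightarrow> 'a topology \<Rightarrow> 'a measure \<Rightarrow> bool" where
  "left_haar_measure G X m \<longleftrightarrow>
     space m = topspace X \<and>
     sets m = sigma_sets (topspace X) {U. openin X U} \<and>
     (\<forall>g\<in>carrier G. \<forall>A\<in>sets m. emeasure m (g <#\<^bsub>G\<^esub> A) = emeasure m A) \<and>
     (\<forall>K. compactin X K \<longrightarrow> emeasure m K < \<infinity>) \<and>
     emeasure m (space m) \<noteq> 0"

definition fundamental_set :: "('a, 'b) monoid_scheme \<Rightarrow> 'a set \<Rightarrow> 'a set \<Rightarrow> bool" where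
  "fundamental_set G H F \<longleftrightarrow>
     F \<subseteq> carrier G \<and>
     (\<Union>\<gamma>\<in>H. \<gamma> <#\<^bsub>G\<^esub> F) = carrier G \<and>
     disjoint_family_on (\<lambda>\<gamma>. \<gamma> <#\<^bsub>G\<^esub> F) H"

text \<open>Since the Haar measure is unique up to a positive factor, it does not matter which one
  is used.\<close>

definition lattice_subgroup ::
    "('a, 'b) monoid_scheme \<Rightarrow> 'a topology \<Rightarrow> 'a set \<Rightarrow> bool" where
  "lattice_subgroup G X H \<longleftrightarrow>
     discrete_subgroup G X H \<and>
     (\<exists>m F. left_haar_measure G X m \<and> F \<in> sets m \<and> fundamental_set G H F \<and> emeasure m F < \<infinity>)"

text \<open>The quotient topology on the space \<open>H\G\<close> of cosets \<open>Hg\<close>.\<close>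

definition coset_space ::
    "('a, 'b) monoid_scheme \<Rightarrow> 'a topology \<Rightarrow> 'a set \<Rightarrow> 'a set topology" where
  "coset_space G X H =
     topology (\<lambda>U. U \<subseteq> rcosets\<^bsub>G\<^esub> H \<and> openin X {g \<in> topspace X. H #>\<^bsub>G\<^esub> g \<in> U})"

lemma openin_coset_space:
  "openin (coset_space G X H) U \<longleftrightarrow>
     U \<subseteq> rcosets\<^bsub>G\<^esub> H \<and> openin X {g \<in> topspace X. H #>\<^bsub>G\<^esub> g \<in> U}"
proof -
  let ?P = "\<lambda>U. {g \<in> topspace X. H #>\<^bsub>G\<^esub> g \<in> U}"
  have "istopology (\<lambda>U. U \<subseteq> rcosets\<^bsub>G\<^esub> H \<and> openin X (?P U))"
    unfolding istopology_def
  proof (intro conjI allI impI)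
    fix S T assume *: "S \<subseteq> rcosets\<^bsub>G\<^esub> H \<and> openin X (?P S)" "T \<subseteq> rcosets\<^bsub>G\<^esub> H \<and> openin X (?P T)"
    have "?P (S \<inter> T) = ?P S \<inter> ?P T" by auto
    then show "openin X (?P (S \<inter> T))" using * by auto
    show "S \<inter> T \<subseteq> rcosets\<^bsub>G\<^esub> H" using * by auto
  next
    fix \<K> assume *: "\<forall>K\<in>\<K>. K \<subseteq> rcosets\<^bsub>G\<^esub> H \<and> openin X (?P K)"
    have "?P (\<Union>\<K>) = \<Union>(?P ` \<K>)" by auto
    moreover have "openin X (\<Union>(?P ` \<K>))" using * by (intro openin_Union) auto
    ultimately show "openin X (?P (\<Union>\<K>))" by simp
    show "\<Union>\<K> \<subseteq> rcosets\<^bsub>G\<^esub> H" using * by auto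
  qed
  then show ?thesis
    by (simp add: coset_space_def topology_inverse')
qed

definition cocompact ::
    "('a, 'b) monoid_scheme \<Rightarrow> 'a topology \<Rightarrow> 'a set \<Rightarrow> bool" where
  "cocompact G X H \<longleftrightarrow> compact_space (coset_space G X H)"

definition SL2R :: "(real^2^2) monoid" where
  "SL2R = \<lparr>carrier = {g. det g = 1}, mult = (**), one = mat 1\<rparr>"

definition SL2R_top :: "(real^2^2) topology" where
  "SL2R_top = top_of_set (carrier SL2R)"


section \<open>The hyperbolic plane\<close>

definition upper_half_plane :: "complex set" where
  "upper_half_plane = {z. Im z > 0}"

text \<open>Transformations of the upper half plane are taken as elements of \<open>BijGroup upper_half_plane\<close>;
  these are extensional functions, i.e. \<open>undefined\<close> outside the upper half plane.\<close>

definition moebius_transf :: "real^2^2 \<Rightarrow> complex \<Rightarrow> complex" where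
  "moebius_transf g =
     restrict (moebius (of_real (g$1$1)) (of_real (g$1$2)) (of_real (g$2$1)) (of_real (g$2$2)))
       upper_half_plane"

definition geodesics :: "complex set set" where
  "geodesics =
     {{z \<in> upper_half_plane. Re z = a} | a. True} \<union>
     {{z \<in> upper_half_plane. cmod (z - of_real a) = r} | a r. r > 0}"

definition geodesic_through :: "complex \<Rightarrow> complex \<Rightarrow> complex set" where
  "geodesic_through p q = (THE l. l \<in> geodesics \<and> p \<in> l \<and> q \<in> l)"

definition imaginary_axis :: "complex set" where
  "imaginary_axis = {z \<in> upper_half_plane. Re z = 0}"

definition reflection_imaginary_axis :: "complex \<Rightarrow> complex" where
  "reflection_imaginary_axis = (\<lambda>z\<in>upper_half_plane. - cnj z)"

text \<open>The result does not depend on the choice of \<open>g\<close>.\<close>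

definition reflection :: "complex set \<Rightarrow> complex \<Rightarrow> complex" where
  "reflection l =
     (let g = (SOME g. g \<in> carrier SL2R \<and> moebius_transf g ` l = imaginary_axis);
          B = BijGroup upper_half_plane
      in inv\<^bsub>B\<^esub> (moebius_transf g) \<otimes>\<^bsub>B\<^esub> reflection_imaginary_axis \<otimes>\<^bsub>B\<^esub> moebius_transf g)"

text \<open>A regular \<open>C\<^sup>1\<close> parametrisation of the geodesic segment from \<open>p\<close> to \<open>q\<close>: an injective path
  from \<open>p\<close> to \<open>q\<close> inside a geodesic runs through exactly the segment between them.\<close>

definition geodesic_arc :: "(real \<Rightarrow> complex) \<Rightarrow> complex \<Rightarrow> complex \<Rightarrow> bool" where
  "geodesic_arc c p q \<longleftrightarrow>
     arc c \<and> pathstart c = p \<and> pathfinish c = q \<and>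
     (\<exists>l\<in>geodesics. path_image c \<subseteq> l) \<and>
     c C1_differentiable_on {0..1} \<and>
     (\<forall>t\<in>{0..1}. vector_derivative c (at t) \<noteq> 0)"

text \<open>The angle at \<open>p\<close> between the segments from \<open>p\<close> to \<open>q\<close> and from \<open>p\<close> to \<open>r\<close>. As the hyperbolic
  metric is conformal to the Euclidean one, the angle between two tangent vectors at \<open>p\<close> is
  the Euclidean angle.\<close>

definition hyp_angle :: "complex \<Rightarrow> complex \<Rightarrow> complex \<Rightarrow> real" where
  "hyp_angle q p r =
     (THE \<theta>. \<exists>c d. geodesic_arc c p q \<and> geodesic_arc d p r \<and>
        (let u = vector_derivative c (at 0); v = vector_derivative d (at 0)
         in \<theta> = arccos ((u \<bullet> v) / (norm u * norm v))))"

text \<open>A geodesic triangle is given by its vertices.\<close>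

definition geodesic_triangle :: "complex \<Rightarrow> complex \<Rightarrow> complex \<Rightarrow> bool" where
  "geodesic_triangle p q r \<longleftrightarrow>
     {p, q, r} \<subseteq> upper_half_plane \<and> (\<forall>l\<in>geodesics. \<not> {p, q, r} \<subseteq> l)"

definition even_products :: "('a, 'b) monoid_scheme \<Rightarrow> 'a set \<Rightarrow> 'a set" where
  "even_products G S =
     {foldr (\<otimes>\<^bsub>G\<^esub>) ws \<one>\<^bsub>G\<^esub> | ws. set ws \<subseteq> S \<and> even (length ws)}"

end

theory Submission
  imports Defs
begin

text \<open>
  A point \<open>z\<close> of the hyperbolic plane is encoded by the vector
  \<open>hvec z = (\<bar>z\<bar>\<^sup>2, Re z, 1) / Im z\<close> of \<open>\<real>\<^sup>3\<close>, which is the hyperboloid model. Geodesics become the zero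
  sets of linear functionals \<open>w\<close> with \<open>lorentz w w = 1\<close>, and the reflection in such a geodesic becomes
  the linear reflection defined by \<open>w\<close>. Take the functionals \<open>w\<^sub>i\<close> of the three sides, with signs
  such that each is positive at the opposite vertex. An angle \<open>\<pi>/n\<close> between two sides means exactly
  that \<open>lorentz w\<^sub>i w\<^sub>j = - cos (\<pi>/n)\<close> (\<open>hyp_angle_lorentz\<close>). Hence \<open>z \<mapsto> (w\<^sub>i \<bullet> hvec z)\<^sub>i\<close> is an
  injective map that carries the three reflections to the generators of the geometric representation of
  a Coxeter group, and the triangle is the set of points whose coordinates are all nonnegative.

  Discreteness is Tits' theorem on this representation (\<open>reflection_increasing_length\<close>): a group
  element that acts nontrivially maps the open triangle to the wrong side of one of the three walls, so
  the image is disjoint from the open triangle (\<open>chamber_disjoint\<close>). An element of \<open>\<Gamma>\<close> close to the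
  identity moves a given interior point very little, so it acts trivially on the plane, and it must
  be the identity matrix. The braid relation, and with it the whole argument,
  depends on the angles being of the form \<open>\<pi>/n\<close>.

  For the covering, consider the orbit of a point and the sum of the hyperbolic cosines of the distances to the
  three vertices. By discreteness this sum attains a minimum on the orbit. A point on the wrong
  side of a wall can be moved strictly closer by a reflection, so the minimum is attained in the
  triangle (\<open>chamber_covers\<close>). The triangle is bounded, because its points are combinations of the
  vertices with coefficients in \<open>[0, 1]\<close>. As \<open>hvec (T\<^sub>g \<i>)\<close> lists the entries of \<open>g g\<^sup>T\<close>, a bounded region
  of the plane corresponds to a bounded set of matrices, and \<open>\<Gamma>\<close> is uniform.

  That a discrete uniform subgroup of \<open>SL\<^sub>2(\<real>)\<close> is a cocompact lattice (\<open>cocompact_lattice\<close>) needs a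
  Haar measure and a Borel fundamental set. The measure of \<open>A\<close> is the Lebesgue measure of the cone
  \<open>{t a. 0 < t \<le> 1, a \<in> A}\<close> in the space of all matrices, on which left multiplication by \<open>SL\<^sub>2(\<real>)\<close> acts by
  linear maps of determinant \<open>1\<close>. The fundamental set is cut out of finitely many small balls.
\<close>

section \<open>The geometric representation of a Coxeter group\<close>

text \<open>The generators in the coordinates \<open>y j = f (\<alpha>\<^sub>j)\<close> of a functional \<open>f\<close>, that is, the
  contragredient of the usual geometric representation. In these coordinates the fundamental
  chamber is the positive orthant.\<close>

definition coxeter_reflection :: "('i \<Rightarrow> 'i \<Rightarrow> nat) \<Rightarrow> 'i \<Rightarrow> ('i \<Rightarrow> real) \<Rightarrow> 'i \<Rightarrow> real" where
  "coxeter_reflection m i y = (\<lambda>j. if j = i then - y i else y j + 2 * cos (pi / m i j) * y i)"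

fun alternating :: "'i \<Rightarrow> 'i \<Rightarrow> nat \<Rightarrow> 'i list" where
  "alternating i j 0 = []"
| "alternating i j (Suc k) = i # alternating j i k"

lemma length_alternating [simp]: "length (alternating i j k) = k"
  by (induction k arbitrary: i j) auto

lemma alternating_snoc:
  "alternating i j (Suc k) = alternating i j k @ [if even k then i else j]"
  by (induction k arbitrary: i j) auto

lemma alternating_split:
  assumes "l \<le> k"
  obtains vs where "alternating i j k = alternating i j l @ vs" "length vs = k - l"
proof -
  have "\<exists>vs. alternating i j k = alternating i j l @ vs \<and> length vs = k - l"
    using assms
  proof (induction l arbitrary: i j k)
    case (Suc l)
    then obtain k' where "k = Suc k'" "l \<le> k'" by (cases k) auto
    then show ?case using Suc.IH[of k' j i] by auto
  qed auto
  then show ?thesis using that by blast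
qed

text \<open>Coxeter matrices without infinite entries.\<close>

locale coxeter_matrix =
  fixes m :: "'i \<Rightarrow> 'i \<Rightarrow> nat"
  assumes m_sym: "m i j = m j i"
    and m_ge_2: "i \<noteq> j \<Longrightarrow> 2 \<le> m i j"
begin

abbreviation s where "s \<equiv> coxeter_reflection m"

abbreviation act :: "'i list \<Rightarrow> ('i \<Rightarrow> real) \<Rightarrow> 'i \<Rightarrow> real" where
  "act ws \<equiv> foldr s ws"

lemma act_append: "act (us @ vs) = act us \<circ> act vs"
  by (simp add: fun_eq_iff)

lemma s_involution: "s i (s i y) = y"
  by (auto simp: coxeter_reflection_def)

text \<open>In the plane of the coordinates \<open>i\<close> and \<open>j\<close>, the product of the two reflections is a rotation
  by \<open>2\<theta>\<close> up to a change of basis. Its powers have entries \<open>sin (l \<theta>) / sin \<theta>\<close>, by the recursion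
  \<open>sin ((l + 1) \<theta>) = 2 cos \<theta> sin (l \<theta>) - sin ((l - 1) \<theta>)\<close>. The two formulas are proved together,
  since prepending a letter expresses each by the other.\<close>

lemma act_alternating_coord:
  fixes y :: "'i \<Rightarrow> real"
  assumes "i \<noteq> j"
  defines "\<theta> \<equiv> pi / m i j"
  shows "act (alternating j i k) y i * sin \<theta> =
           sin ((real k + 1) * \<theta>) * (if even k then y i else y j) +
           sin (real k * \<theta>) * (if even k then y j else y i)"
    and "act (alternating i j k) y i * sin \<theta> =
           - (sin (real k * \<theta>) * (if even k then y j else y i) +
              sin ((real k - 1) * \<theta>) * (if even k then y i else y j))"
proof -
  have "(\<forall>i j. i \<noteq> j \<longrightarrow> \<theta> = pi / m i j \<longrightarrow> 
     act (alternating j i k) y i * sin \<theta> =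
           sin ((real k + 1) * \<theta>) * (if even k then y i else y j) +
           sin (real k * \<theta>) * (if even k then y j else y i) \<and>
     act (alternating i j k) y i * sin \<theta> =
           - (sin (real k * \<theta>) * (if even k then y j else y i) +
              sin ((real k - 1) * \<theta>) * (if even k then y i else y j)))"
  proof (induction k)
    case 0
    then show ?case by simp
  next
    case (Suc k)
    show ?case
    proof (intro allI impI)
      fix i j assume ij: "i \<noteq> j" and \<theta>: "\<theta> = pi / m i j"
      have \<theta>': "\<theta> = pi / m j i" using \<theta> m_sym by metis
      let ?P = "\<lambda>k. if even k then y i else y j" and ?Q = "\<lambda>k. if even k then y j else y i"
      have A: "act (alternating j i k) y i * sin \<theta> =
           sin ((real k + 1) * \<theta>) * ?P k + sin (real k * \<theta>) * ?Q k"
        and B: "act (alternating i j k) y i * sin \<theta> =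
           - (sin (real k * \<theta>) * ?Q k + sin ((real k - 1) * \<theta>) * ?P k)"
        and A': "act (alternating i j k) y j * sin \<theta> =
           sin ((real k + 1) * \<theta>) * ?Q k + sin (real k * \<theta>) * ?P k"
        using Suc.IH[rule_format, OF ij \<theta>] Suc.IH[rule_format, OF ij[symmetric] \<theta>'] by auto
      have sum: "2 * cos \<theta> * sin (real l * \<theta>) = sin ((real l + 1) * \<theta>) + sin ((real l - 1) * \<theta>)" for l
        by (simp add: sin_add sin_diff algebra_simps)
      have "act (alternating j i (Suc k)) y i = act (alternating i j k) y i + 2 * cos \<theta> * act (alternating i j k) y j"
        using ij \<theta>' by (simp add: coxeter_reflection_def)
      then have "act (alternating j i (Suc k)) y i * sin \<theta> =
         act (alternating i j k) y i * sin \<theta> + 2 * cos \<theta> * (act (alternating i j k) y j * sin \<theta>)"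
        by (simp add: algebra_simps)
      also have "\<dots> = - (sin (real k * \<theta>) * ?Q k + sin ((real k - 1) * \<theta>) * ?P k) +
          (2 * cos \<theta> * sin (real (Suc k) * \<theta>)) * ?Q k + (2 * cos \<theta> * sin (real k * \<theta>)) * ?P k"
        unfolding A' B by (simp only: of_nat_Suc) (simp add: algebra_simps)
      also have "\<dots> = sin ((real (Suc k) + 1) * \<theta>) * ?Q k + sin (real (Suc k) * \<theta>) * ?P k"
        unfolding sum by (simp add: algebra_simps)
      finally have 1: "act (alternating j i (Suc k)) y i * sin \<theta> =
          sin ((real (Suc k) + 1) * \<theta>) * ?P (Suc k) + sin (real (Suc k) * \<theta>) * ?Q (Suc k)"
        by simp
      have "act (alternating i j (Suc k)) y i = - act (alternating j i k) y i"
        by (simp add: coxeter_reflection_def)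
      then have 2: "act (alternating i j (Suc k)) y i * sin \<theta> = 
          - (sin (real (Suc k) * \<theta>) * ?Q (Suc k) + sin ((real (Suc k) - 1) * \<theta>) * ?P (Suc k))"
        using A by (simp add: algebra_simps)
      show "act (alternating j i (Suc k)) y i * sin \<theta> =
          sin ((real (Suc k) + 1) * \<theta>) * ?P (Suc k) + sin (real (Suc k) * \<theta>) * ?Q (Suc k) \<and>
         act (alternating i j (Suc k)) y i * sin \<theta> = 
          - (sin (real (Suc k) * \<theta>) * ?Q (Suc k) + sin ((real (Suc k) - 1) * \<theta>) * ?P (Suc k))"
        using 1 2 by blast
    qed
  qed
  then show "act (alternating j i k) y i * sin \<theta> =
           sin ((real k + 1) * \<theta>) * (if even k then y i else y j) +
           sin (real k * \<theta>) * (if even k then y j else y i)"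
    and "act (alternating i j k) y i * sin \<theta> =
           - (sin (real k * \<theta>) * (if even k then y j else y i) +
              sin ((real k - 1) * \<theta>) * (if even k then y i else y j))"
    using assms by blast+
qed

lemma sin_angle_pos: "i \<noteq> j \<Longrightarrow> 0 < sin (pi / m i j)"
  using m_ge_2[of i j] by (intro sin_gt_zero) (auto simp: field_simps)

text \<open>For words shorter than \<open>m i j\<close> the coefficients \<open>sin ((k + 1) \<theta>)\<close> and \<open>sin (k \<theta>)\<close> are
  nonnegative, since their arguments do not exceed \<open>\<pi>\<close>.\<close>

lemma act_alternating_nonneg:
  assumes "i \<noteq> j" "k < m i j" "0 \<le> y i" "0 \<le> y j"
  shows "0 \<le> act (alternating j i k) y i"
proof -
  let ?\<theta> = "pi / m i j"
  have "0 \<le> sin (real l * ?\<theta>)" if "l \<le> m i j" for l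
  proof (rule sin_ge_zero)
    show "real l * ?\<theta> \<le> pi" using that m_ge_2[OF assms(1)] by (auto simp: field_simps)
  qed auto
  from this[of k] this[of "Suc k"] have "0 \<le> act (alternating j i k) y i * sin ?\<theta>"
    using assms by (subst act_alternating_coord) (auto simp: algebra_simps)
  then show ?thesis
    using sin_angle_pos[OF assms(1)] by (simp add: zero_le_mult_iff)
qed

text \<open>On the coordinates \<open>i\<close> and \<open>j\<close> the relation is read off from the sine formulas. Another
  coordinate \<open>k\<close> can be corrected by a combination of the coordinates \<open>i\<close> and \<open>j\<close> so that both
  reflections fix it. This amounts to solving a linear system with determinant \<open>1 - cos\<^sup>2 \<theta> \<noteq>
  0\<close>.\<close>

lemma braid_relation:
  assumes "i \<noteq> j"
  shows "act (alternating i j (m i j)) = act (alternating j i (m i j))"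
proof (intro ext)
  fix y k
  let ?m = "m i j" and ?\<theta> = "pi / m i j"
  have m0: "?m > 0" using m_ge_2[OF assms] by simp
  have sn: "sin ?\<theta> \<noteq> 0" using sin_angle_pos[OF assms] by simp
  have vals: "sin (real ?m * ?\<theta>) = 0" "sin ((real ?m + 1) * ?\<theta>) = - sin ?\<theta>" "sin ((real ?m - 1) * ?\<theta>) = sin ?\<theta>"
  proof -
    have "real ?m * ?\<theta> = pi" using m0 by simp
    then have "(real ?m + 1) * ?\<theta> = pi + ?\<theta>" "(real ?m - 1) * ?\<theta> = pi - ?\<theta>"
      by (simp_all add: ring_distribs add_divide_distrib diff_divide_distrib)
    then show "sin (real ?m * ?\<theta>) = 0" "sin ((real ?m + 1) * ?\<theta>) = - sin ?\<theta>" "sin ((real ?m - 1) * ?\<theta>) = sin ?\<theta>"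
      using \<open>real ?m * ?\<theta> = pi\<close> by (simp_all only: sin_pi sin_add sin_diff cos_pi mult_1 mult_zero_left mult_minus1 mult_zero_right add_0 add_0_right diff_0 minus_minus mult_minus_left)
  qed
  have eq_i: "act (alternating i j ?m) y i = act (alternating j i ?m) y i"
  proof -
    have "act (alternating i j ?m) y i * sin ?\<theta> = act (alternating j i ?m) y i * sin ?\<theta>"
      unfolding act_alternating_coord[OF assms] vals by simp
    then show ?thesis using sn by simp
  qed
  have eq_j: "act (alternating i j ?m) y j = act (alternating j i ?m) y j"
  proof -
    have "act (alternating i j ?m) y j * sin ?\<theta> = act (alternating j i ?m) y j * sin ?\<theta>"
      using act_alternating_coord[OF assms[symmetric], of ?m y] unfolding m_sym[of j i] vals by simp
    then show ?thesis using sn by simp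
  qed
  show "act (alternating i j ?m) y k = act (alternating j i ?m) y k"
  proof (cases "k = i \<or> k = j")
    case False
    define c where "c = cos ?\<theta>"
    have c2: "1 - c\<^sup>2 \<noteq> 0" using sn sin_squared_eq[of ?\<theta>] by (auto simp: c_def)
    define p where "p = (cos (pi / m i k) + c * cos (pi / m j k)) / (1 - c\<^sup>2)"
    define q where "q = (cos (pi / m j k) + c * cos (pi / m i k)) / (1 - c\<^sup>2)"
    have p: "cos (pi / m i k) = p - c * q" and q: "cos (pi / m j k) = q - c * p"
    proof -
      have pq: "p * (1 - c\<^sup>2) = cos (pi / m i k) + c * cos (pi / m j k)"
           "q * (1 - c\<^sup>2) = cos (pi / m j k) + c * cos (pi / m i k)"
        using c2 by (simp_all add: p_def q_def)
      have "(p - c * q) * (1 - c\<^sup>2) = p * (1 - c\<^sup>2) - c * (q * (1 - c\<^sup>2))"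
           "(q - c * p) * (1 - c\<^sup>2) = q * (1 - c\<^sup>2) - c * (p * (1 - c\<^sup>2))"
        by (simp_all add: algebra_simps)
      then have "(p - c * q) * (1 - c\<^sup>2) = cos (pi / m i k) * (1 - c\<^sup>2)"
           "(q - c * p) * (1 - c\<^sup>2) = cos (pi / m j k) * (1 - c\<^sup>2)"
        unfolding pq by (simp_all add: algebra_simps power2_eq_square)
      then show "cos (pi / m i k) = p - c * q" "cos (pi / m j k) = q - c * p"
        using c2 by auto
    qed
    define corr where "corr y = y k + p * y i + q * y j" for y :: "'i \<Rightarrow> real"
    have c': "cos (pi / m j i) = c" "cos (pi / m i j) = c" by (simp_all add: c_def m_sym[of j i])
    have "corr (s i y) = corr y" "corr (s j y) = corr y" for y
      using False assms by (simp_all add: corr_def coxeter_reflection_def p q c' algebra_simps)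
    then have *: "corr (act (alternating i j l) y) = corr y \<and> corr (act (alternating j i l) y) = corr y" for l y
      by (induction l) auto
    from *[of ?m y] show ?thesis using eq_i eq_j by (simp add: corr_def)
  qed (use eq_i eq_j in auto)
qed

text \<open>The length in the linear group: words count as equal when they act equally.\<close>

definition word_length :: "'i list \<Rightarrow> nat" where
  "word_length ws = (LEAST n. \<exists>vs. length vs = n \<and> act vs = act ws)"

lemma reduced_word:
  obtains vs where "length vs = word_length ws" "act vs = act ws"
  using LeastI_ex[of "\<lambda>n. \<exists>vs. length vs = n \<and> act vs = act ws"] that
  unfolding word_length_def by blast

lemma word_length_le: "act vs = act ws \<Longrightarrow> word_length ws \<le> length vs"
  unfolding word_length_def by (intro Least_le) auto

lemma word_length_cong: "act vs = act ws \<Longrightarrow> word_length vs = word_length ws"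
  by (simp add: word_length_def)

lemma word_length_append: "word_length (us @ ws) \<le> length us + word_length ws"
proof -
  obtain vs where "length vs = word_length ws" "act vs = act ws" by (rule reduced_word)
  then show ?thesis using word_length_le[of "us @ vs" "us @ ws"] by (simp add: act_append)
qed

lemma word_length_cancel: "word_length ws \<le> Suc (word_length (i # ws))"
proof -
  have "word_length ws = word_length ([i] @ i # ws)"
    by (rule word_length_cong) (auto simp: s_involution)
  then show ?thesis using word_length_append[of "[i]" "i # ws"] by simp
qed

text \<open>Tits' lemma: if prepending the letter \<open>i\<close> does not shorten \<open>ws\<close>, then \<open>ws\<close> maps the closed
  chamber to the positive side of the wall \<open>i\<close>. The proof is by induction on the length. A
  reduced word for \<open>ws\<close> starts with some \<open>j \<noteq> i\<close>. Split off the longest possible prefix that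
  alternates between \<open>j\<close> and \<open>i\<close> without loss of length, say \<open>ws = u v\<close>. Since it is longest,
  neither letter shortens \<open>v\<close>, so by induction \<open>v\<close> maps the chamber to the positive side of both
  walls. If \<open>u\<close> had \<open>m i j\<close> or more letters, the braid relation would let \<open>ws\<close> start with \<open>i\<close>,
  and \<open>i\<close> would shorten it. So \<open>u\<close> is short, and \<open>act_alternating_nonneg\<close> applies.\<close>

theorem reflection_increasing_length:
  assumes "word_length ws \<le> word_length (i # ws)" and "\<And>j. 0 \<le> y j"
  shows "0 \<le> act ws y i"
  using assms(1)
proof (induction "word_length ws" arbitrary: ws i rule: less_induct)
  case less
  obtain vs where vs: "length vs = word_length ws" "act vs = act ws" by (rule reduced_word)
  show ?case
  proof (cases vs)
    case Nil
    then have "act ws y = y" using vs by (metis foldr_Nil id_apply)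
    then show ?thesis using assms(2) by simp
  next
    case (Cons j vs')
    have ji: "j \<noteq> i"
    proof
      assume "j = i"
      then have "act vs' = act (i # ws)"
        using vs Cons by (auto simp: s_involution fun_eq_iff simp flip: vs(2))
      then have "word_length (i # ws) \<le> length vs'" by (rule word_length_le)
      then show False using less.prems vs Cons by simp
    qed
    \<comment> \<open>\<open>Q k\<close>: an alternating prefix of length \<open>k\<close> can be split off without loss of length.\<close>
    define Q where "Q k \<longleftrightarrow> (\<exists>v. act ws = act (alternating j i k @ v) \<and> k + word_length v = word_length ws)" for k
    have Q1: "Q 1"
      unfolding Q_def
    proof (intro exI conjI)
      show *: "act ws = act (alternating j i 1 @ vs')" using vs Cons by simp
      have "word_length ws \<le> 1 + word_length vs'"
        using word_length_append[of "[j]" vs'] word_length_cong[OF *] by simp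
      moreover have "word_length vs' \<le> length vs'" by (rule word_length_le) simp
      ultimately show "1 + word_length vs' = word_length ws" using vs Cons by simp
    qed
    obtain k where k: "Q k" and k_max: "\<And>l. Q l \<Longrightarrow> l \<le> k"
      using Nat.ex_has_greatest_nat[of Q 1 "word_length ws"] Q1 by (metis Q_def le_add1)
    have "1 \<le> k" using k_max Q1 by blast
    then obtain k' where k': "k = Suc k'" by (cases k) auto
    obtain v where v: "act ws = act (alternating j i k @ v)" "k + word_length v = word_length ws"
      using k unfolding Q_def by blast
    have "k < m i j"
    proof (rule ccontr)
      assume "\<not> k < m i j"
      then obtain us where us: "alternating j i k = alternating j i (m i j) @ us" "length us = k - m i j"
        using alternating_split[of "m i j" k j i] by auto
      obtain l where l: "m i j = Suc l" using m_ge_2[of i j] ji by (cases "m i j") auto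
      have "act ws = act (alternating i j (m i j) @ us @ v)"
        using v us braid_relation[of i j] ji by (simp add: act_append)
      then have "act (i # ws) = act (alternating j i l @ us @ v)"
        by (auto simp: l s_involution)
      then have "word_length (i # ws) = word_length ((alternating j i l @ us) @ v)"
        by (intro word_length_cong) simp
      also have "\<dots> \<le> l + (k - m i j) + word_length v"
        using word_length_append[of "alternating j i l @ us" v] us by simp
      also have "\<dots> < word_length ws" using v l \<open>\<not> k < m i j\<close> by simp
      finally show False using less.prems by simp
    qed
    \<comment> \<open>\<open>e\<close> is the last letter of the prefix and \<open>e'\<close> the letter that would continue the
      alternation.\<close>
    define e where "e = (if even k' then j else i)"
    define e' where "e' = (if even k then j else i)"
    have "{e, e'} = {i, j}" using k' by (auto simp: e_def e'_def)
    have e: "word_length v \<le> word_length (e # v)"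
    proof -
      have *: "act ws = act (alternating j i k' @ e # v)"
        using v(1) unfolding k' alternating_snoc e_def by simp
      then have "word_length ws \<le> k' + word_length (e # v)"
        using word_length_append[of "alternating j i k'" "e # v"] word_length_cong[OF *] by simp
      then show ?thesis using v(2) k' by simp
    qed
    have e': "word_length v \<le> word_length (e' # v)"
    proof (rule ccontr)
      assume *: "\<not> ?thesis"
      have act': "act ws = act (alternating j i (Suc k) @ e' # v)"
        unfolding alternating_snoc e'_def using v(1) by (auto simp: s_involution)
      have "Suc k + word_length (e' # v) = word_length ws"
        using * v(2) word_length_cancel[of v e'] by simp
      then have "Q (Suc k)" unfolding Q_def using act' by blast
      then show False using k_max by fastforce
    qed
    have small: "word_length v < word_length ws" using v(2) \<open>1 \<le> k\<close> by simp
    have "0 \<le> act v y e" "0 \<le> act v y e'"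
      using less.hyps[OF small e] less.hyps[OF small e'] by auto
    then have "0 \<le> act v y i" "0 \<le> act v y j"
      using \<open>{e, e'} = {i, j}\<close> by (auto simp: doubleton_eq_iff)
    then have "0 \<le> act (alternating j i k) (act v y) i"
      using ji \<open>k < m i j\<close> by (intro act_alternating_nonneg) auto
    then show ?thesis using v(1) by simp
  qed
qed

text \<open>Strip the first letter \<open>i\<close> of a reduced word. The rest maps the chamber to the positive side
  of the wall \<open>i\<close>, and the reflection \<open>i\<close> maps it to the negative side.\<close>

corollary chamber_disjoint:
  assumes "act ws \<noteq> id" 
  obtains i where "\<And>y. (\<And>j. 0 \<le> y j) \<Longrightarrow> act ws y i \<le> 0"
proof -
  obtain vs where vs: "length vs = word_length ws" "act vs = act ws" by (rule reduced_word)
  with assms obtain i vs' where Cons: "vs = i # vs'" by (cases vs) (auto simp: id_def)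
  have act: "act (i # vs') = act ws" using vs Cons by simp
  have "word_length vs' \<le> length vs'" by (rule word_length_le) simp
  also have "\<dots> \<le> word_length (i # vs')" using vs Cons word_length_cong[OF act] by simp
  finally have "0 \<le> act vs' y i" if "\<And>j. 0 \<le> y j" for y
    using that reflection_increasing_length by blast
  then have "act ws y i \<le> 0" if "\<And>j. 0 \<le> y j" for y
    using that by (simp flip: act add: coxeter_reflection_def)
  then show ?thesis using that by blast
qed

end

section \<open>The group of real unimodular two by two matrices\<close>

lemmas mat2_simps = matrix_matrix_mult_def matrix_vector_mult_def vec_eq_iff forall_2 sum_2 det_2 mat_def

text \<open>The adjugate is the inverse on \<open>SL\<^sub>2(\<real>)\<close> and is a linear, hence everywhere continuous,
  function of the matrix.\<close>

definition adj2 :: "real^2^2 \<Rightarrow> real^2^2" where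
  "adj2 g = vector [vector [g$2$2, - g$1$2], vector [- g$2$1, g$1$1]]"

lemma carrier_SL2R: "carrier SL2R = {g. det g = 1}"
  and mult_SL2R: "g \<otimes>\<^bsub>SL2R\<^esub> h = g ** h"
  and one_SL2R: "\<one>\<^bsub>SL2R\<^esub> = mat 1"
  by (simp_all add: SL2R_def)

lemma det_adj2 [simp]: "det (adj2 g) = det g"
  by (simp add: adj2_def det_2)

lemma adj2_mult: "det g = 1 \<Longrightarrow> adj2 g ** g = mat 1" "det g = 1 \<Longrightarrow> g ** adj2 g = mat 1"
  by (simp_all add: adj2_def mat2_simps algebra_simps)

lemma adj2_cancel: "det g = 1 \<Longrightarrow> adj2 g ** (g ** h) = h" "det g = 1 \<Longrightarrow> g ** (adj2 g ** h) = h"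
  by (simp_all add: matrix_mul_assoc adj2_mult)

lemma group_SL2R: "group SL2R"
proof (rule groupI)
  fix x assume "x \<in> carrier SL2R"
  then show "\<exists>y\<in>carrier SL2R. y \<otimes>\<^bsub>SL2R\<^esub> x = \<one>\<^bsub>SL2R\<^esub>"
    by (intro bexI[of _ "adj2 x"]) (auto simp: SL2R_def adj2_mult)
qed (auto simp: SL2R_def det_mul matrix_mul_assoc)

lemma inv_SL2R: "g \<in> carrier SL2R \<Longrightarrow> inv\<^bsub>SL2R\<^esub> g = adj2 g"
  by (rule group.inv_equality[OF group_SL2R]) (auto simp: SL2R_def adj2_mult)

lemma l_coset_SL2R: "g <#\<^bsub>SL2R\<^esub> A = (**) g ` A"
  by (auto simp: l_coset_def SL2R_def)

lemma continuous_on_matrix_mult [continuous_intros]: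
  fixes f g :: "'a::topological_space \<Rightarrow> real^2^2"
  assumes "continuous_on S f" "continuous_on S g"
  shows "continuous_on S (\<lambda>x. f x ** g x)"
  unfolding matrix_matrix_mult_def
  by (intro continuous_intros assms)

lemma continuous_on_left_mult: "continuous_on S ((**) g :: real^2^2 \<Rightarrow> real^2^2)"
  using continuous_on_matrix_mult[of S "\<lambda>_. g" "\<lambda>x. x"] by (simp add: continuous_on_const continuous_on_id)

lemma continuous_on_adj2 [continuous_intros]:
  fixes f :: "'a::topological_space \<Rightarrow> real^2^2"
  assumes "continuous_on S f"
  shows "continuous_on S (\<lambda>x. adj2 (f x))"
proof -
  have "adj2 h = (\<chi> i j. if i = j then (if i = 1 then h$2$2 else h$1$1) else - h$i$j)" for h
    by (simp add: adj2_def vec_eq_iff forall_2)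
  moreover have "continuous_on S (\<lambda>x. \<chi> i j. if i = j then (if i = 1 then f x$2$2 else f x$1$1) else - f x$i$j)"
  proof (intro continuous_on_vec_lambda)
    fix i j :: 2
    show "continuous_on S (\<lambda>x. if i = j then (if i = 1 then f x$2$2 else f x$1$1) else - f x$i$j)"
      by (cases "i = j"; cases "i = 1") (auto intro!: continuous_intros assms)
  qed
  ultimately show ?thesis by simp
qed

lemma closed_SL2: "closed {g :: real^2^2. det g = 1}"
  unfolding det_2 by (intro closed_Collect_eq continuous_intros)

lemma topspace_SL2R_top [simp]: "topspace SL2R_top = {g. det g = 1}"
  by (simp add: SL2R_top_def carrier_SL2R)

lemma compactin_SL2R_top: "compactin SL2R_top K \<longleftrightarrow> compact K \<and> K \<subseteq> {g. det g = 1}"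
  by (auto simp: SL2R_top_def carrier_SL2R compactin_subtopology)

section \<open>Haar measure on SL(2,R)\<close>

text \<open>For the Haar measure a matrix is taken as the pair of its columns: left multiplication acts on
  both columns separately, so its effect on Lebesgue measure follows from the case of \<open>\<real>\<^sup>2\<close> and
  the product formula.\<close>

definition det_columns :: "(real^2) \<times> (real^2) \<Rightarrow> real" where
  "det_columns x = fst x $ 1 * snd x $ 2 - snd x $ 1 * fst x $ 2"

definition det_cone :: "((real^2) \<times> (real^2)) set" where
  "det_cone = {x. 0 < det_columns x \<and> det_columns x \<le> 1}"

definition normalise :: "(real^2) \<times> (real^2) \<Rightarrow> real^2^2" where
  "normalise x = (1 / sqrt (det_columns x)) *\<^sub>R (\<chi> i j. if j = 1 then fst x $ i else snd x $ i)"

text \<open>The measure of \<open>A\<close> is the Lebesgue measure of the part of the cone over \<open>A\<close> with determinant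
  at most \<open>1\<close>.\<close>

definition SL2_haar :: "(real^2^2) measure" where
  "SL2_haar = distr (restrict_space lborel det_cone) (restrict_space borel {g. det g = 1}) normalise"

lemma continuous_on_det_columns [continuous_intros]: "continuous_on S det_columns"
  unfolding det_columns_def by (intro continuous_intros)

lemma det_cone_borel [measurable]: "det_cone \<in> sets borel"
proof -
  have "det_cone = {x. 0 < det_columns x} \<inter> {x. det_columns x \<le> 1}" by (auto simp: det_cone_def)
  moreover have "open {x. 0 < det_columns x}" by (intro open_Collect_less continuous_intros)
  moreover have "closed {x. det_columns x \<le> 1}" by (intro closed_Collect_le continuous_intros)
  ultimately show ?thesis by (metis borel_open borel_closed sets.Int)
qed

lemma det_normalise: "0 < det_columns x \<Longrightarrow> det (normalise x) = 1"
proof -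
  assume d: "0 < det_columns x"
  define r where "r = 1 / sqrt (det_columns x)"
  have "det (normalise x) = r * r * det_columns x"
    unfolding normalise_def r_def[symmetric] by (simp add: det_2 det_columns_def algebra_simps)
  then show ?thesis using d by (simp add: r_def)
qed

lemma measurable_normalise: "normalise \<in> measurable (restrict_space lborel det_cone) (restrict_space borel {g. det g = 1})"
proof (rule measurable_restrict_space2)
  show "normalise \<in> space (restrict_space lborel det_cone) \<rightarrow> {g. det g = 1}"
    by (auto simp: space_restrict_space det_cone_def det_normalise)
  have "continuous_on det_cone (\<lambda>x. (\<chi> i j. if j = 1 then fst x $ i else snd x $ i) :: real^2^2)"
  proof (intro continuous_on_vec_lambda)
    fix i j :: 2
    show "continuous_on det_cone (\<lambda>x. if j = 1 then fst x $ i else snd x $ i)"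
      by (cases "j = 1") (auto intro!: continuous_intros)
  qed
  then have "continuous_on det_cone normalise"
    unfolding normalise_def
    by (intro continuous_on_scaleR continuous_on_divide continuous_on_real_sqrt continuous_on_const
        continuous_on_det_columns) (auto simp: det_cone_def)
  then have "normalise \<in> borel_measurable (restrict_space borel det_cone)"
    by (rule borel_measurable_continuous_on_restrict)
  then show "normalise \<in> borel_measurable (restrict_space lborel det_cone)"
    by (simp cong: measurable_cong_sets sets_restrict_space_cong)
qed

lemma sets_SL2_haar: "sets SL2_haar = sets (restrict_space borel {g. det g = 1})"
  by (simp add: SL2_haar_def)

lemma SL2_borel: "{g :: real^2^2. det g = 1} \<in> sets borel"
  using closed_SL2 by (rule borel_closed)

lemma in_sets_SL2_haar: "A \<in> sets SL2_haar \<longleftrightarrow> A \<in> sets borel \<and> A \<subseteq> {g. det g = 1}"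
  unfolding sets_SL2_haar using SL2_borel by (subst sets_restrict_space_iff) auto

lemma emeasure_SL2_haar:
  assumes "A \<in> sets SL2_haar"
  shows "emeasure SL2_haar A = emeasure lborel {x \<in> det_cone. normalise x \<in> A}"
    and "{x \<in> det_cone. normalise x \<in> A} \<in> sets borel"
proof -
  let ?E = "{x \<in> det_cone. normalise x \<in> A}"
  have A: "A \<in> sets (restrict_space borel {g. det g = 1})" using assms by (simp add: sets_SL2_haar)
  have E: "normalise -` A \<inter> space (restrict_space lborel det_cone) = ?E"
    by (auto simp: space_restrict_space)
  have "?E \<in> sets (restrict_space lborel det_cone)"
    using measurable_sets[OF measurable_normalise A] E by simp
  then show "?E \<in> sets borel" by (subst (asm) sets_restrict_space_iff) auto
  show "emeasure SL2_haar A = emeasure lborel ?E"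
    unfolding SL2_haar_def
    by (subst emeasure_distr[OF measurable_normalise A], subst E, rule emeasure_restrict_space) auto
qed

lemma lborel_unimodular:
  fixes h :: "real^2^2"
  assumes "det h = 1"
  shows "distr lborel lborel ((*v) h) = (lborel :: (real^2) measure)"
proof (rule lborel_eqI[symmetric])
  fix l u :: "real^2" assume lu: "\<And>b. b \<in> Basis \<Longrightarrow> l \<bullet> b \<le> u \<bullet> b"
  have meas: "(*v) h \<in> measurable lborel lborel"
    by (simp add: borel_measurable_continuous_onI matrix_vector_mult_linear_continuous_on)
  have eq: "(*v) h -` box l u = (*v) (adj2 h) ` box l u"
  proof (safe)
    fix x assume "h *v x \<in> box l u"
    then show "x \<in> (*v) (adj2 h) ` box l u"
      by (intro image_eqI[of _ _ "h *v x"]) (simp_all add: matrix_vector_mul_assoc adj2_mult assms)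
  qed (simp add: matrix_vector_mul_assoc adj2_mult assms)
  have lm: "(*v) (adj2 h) ` box l u \<in> lmeasurable"
    by (intro measurable_linear_image) auto
  have "emeasure (distr lborel lborel ((*v) h)) (box l u) = emeasure lborel ((*v) h -` box l u)"
    by (subst emeasure_distr[OF meas]) auto
  also have "\<dots> = emeasure lebesgue ((*v) h -` box l u)"
    using measurable_sets[OF meas, of "box l u"] by simp
  also have "\<dots> = ennreal (measure lebesgue ((*v) (adj2 h) ` box l u))"
    unfolding eq using lm by (simp add: emeasure_eq_measure2)
  also have "measure lebesgue ((*v) (adj2 h) ` box l u) = measure lebesgue (box l u)"
    by (subst measure_linear_image) (auto simp: assms)
  also have "\<dots> = (\<Prod>b\<in>Basis. (u - l) \<bullet> b)"
    using lu by (simp add: measure_lborel_box)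
  finally show "emeasure (distr lborel lborel ((*v) h)) (box l u) = ennreal (\<Prod>b\<in>Basis. (u - l) \<bullet> b)" .
qed simp

lemma emeasure_lborel_mult_columns:
  fixes h :: "real^2^2"
  assumes "det h = 1" and E: "E \<in> sets borel"
  shows "emeasure lborel {x. (h *v fst x, h *v snd x) \<in> E} = emeasure lborel E"
proof -
  let ?L = "\<lambda>(x :: real^2, y :: real^2). (h *v x, h *v y)"
  have meas: "(*v) h \<in> measurable lborel lborel"
    by (simp add: borel_measurable_continuous_onI matrix_vector_mult_linear_continuous_on)
  have sf: "sigma_finite_measure (distr lborel lborel ((*v) h))"
    unfolding lborel_unimodular[OF assms(1)] by (rule sigma_finite_lborel)
  have "distr (lborel \<Otimes>\<^sub>M lborel) (lborel \<Otimes>\<^sub>M lborel) ?L = lborel \<Otimes>\<^sub>M lborel"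
    using pair_measure_distr[OF meas meas sf] unfolding lborel_unimodular[OF assms(1)] by simp
  then have *: "distr lborel lborel ?L = lborel" by (simp add: lborel_prod)
  have "?L \<in> borel_measurable borel"
    unfolding case_prod_unfold matrix_vector_mult_def
    by (intro borel_measurable_continuous_onI continuous_intros)
  then have "emeasure (distr lborel lborel ?L) E = emeasure lborel (?L -` E)"
    using E by (subst emeasure_distr) auto
  also have "?L -` E = {x. (h *v fst x, h *v snd x) \<in> E}" by auto
  finally show ?thesis unfolding * by simp
qed

lemma SL2_haar_left_invariant:
  assumes "det g = 1" and A: "A \<in> sets SL2_haar"
  shows "emeasure SL2_haar ((**) g ` A) = emeasure SL2_haar A"
proof -
  let ?h = "adj2 g"
  have h: "det ?h = 1" using assms by simp
  have im: "(**) g ` A = {x. ?h ** x \<in> A}"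
    using assms by (auto simp: adj2_cancel intro!: image_eqI[of _ _ "?h ** _"])
  have "((**) ?h :: real^2^2 \<Rightarrow> real^2^2) \<in> borel_measurable borel"
    by (intro borel_measurable_continuous_onI continuous_on_left_mult)
  then have "(**) ?h -` A \<in> sets borel"
    using A measurable_sets[of "\<lambda>x. ?h ** x" borel borel A] by (simp add: in_sets_SL2_haar)
  then have gA: "(**) g ` A \<in> sets SL2_haar"
    using A assms unfolding in_sets_SL2_haar im by (auto simp: vimage_def in_sets_SL2_haar) 
       (metis (mono_tags, lifting) assms(1) det_adj2 det_mul mem_Collect_eq mult_1 subsetD)
  have d: "det_columns (?h *v fst x, ?h *v snd x) = det_columns x" for x
  proof -
    have "det_columns (?h *v fst x, ?h *v snd x) = det ?h * det_columns x"
      by (simp only: det_columns_def mat2_simps fst_conv snd_conv vec_lambda_beta) (simp add: algebra_simps)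
    then show ?thesis using h by simp
  qed
  have n: "normalise (?h *v fst x, ?h *v snd x) = ?h ** normalise x" for x
    unfolding normalise_def d by (simp add: mat2_simps algebra_simps add_divide_distrib)
  have "emeasure SL2_haar A = emeasure lborel {x \<in> det_cone. normalise x \<in> A}"
    using emeasure_SL2_haar(1)[OF A] .
  also have "\<dots> = emeasure lborel {x. (?h *v fst x, ?h *v snd x) \<in> {x \<in> det_cone. normalise x \<in> A}}"
    by (rule emeasure_lborel_mult_columns[symmetric, OF h emeasure_SL2_haar(2)[OF A]])
  also have "{x. (?h *v fst x, ?h *v snd x) \<in> {x \<in> det_cone. normalise x \<in> A}} =
      {x \<in> det_cone. normalise x \<in> (**) g ` A}"
    unfolding im by (auto simp: n d det_cone_def)
  finally show ?thesis using emeasure_SL2_haar(1)[OF gA] by simp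
qed

text \<open>The cone over a bounded set, cut off at determinant \<open>1\<close>, is bounded.\<close>

lemma SL2_haar_bounded_finite:
  assumes A: "A \<in> sets SL2_haar" and "bounded A"
  shows "emeasure SL2_haar A < \<infinity>"
proof -
  obtain B where "\<forall>x\<in>A. norm x \<le> B" using \<open>bounded A\<close> unfolding bounded_iff ..
  then have B: "A \<subseteq> cball 0 B" by auto
  let ?f = "\<lambda>(t::real, a::real^2^2). (t *\<^sub>R (\<chi> i. a$i$1), t *\<^sub>R (\<chi> i. a$i$2)) :: (real^2) \<times> (real^2)"
  let ?C = "?f ` ({0..1} \<times> cball 0 B)"
  have "compact ?C"
    unfolding case_prod_unfold
    by (intro compact_continuous_image compact_Times compact_Icc compact_cball continuous_intros)
  have "{x \<in> det_cone. normalise x \<in> A} \<subseteq> ?C"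
  proof
    fix x assume x: "x \<in> {x \<in> det_cone. normalise x \<in> A}"
    then have "0 < det_columns x" "det_columns x \<le> 1" by (auto simp: det_cone_def)
    then have "x = ?f (sqrt (det_columns x), normalise x)"
      by (cases x) (simp add: normalise_def vec_eq_iff)
    then show "x \<in> ?C"
      using x B \<open>det_columns x \<le> 1\<close> \<open>0 < det_columns x\<close> by (intro image_eqI[of _ _ "(sqrt (det_columns x), normalise x)"]) auto
  qed
  then have "emeasure SL2_haar A \<le> emeasure lborel ?C"
    unfolding emeasure_SL2_haar(1)[OF A] using borel_compact[OF \<open>compact ?C\<close>] by (intro emeasure_mono) simp_all
  also have "\<dots> < \<infinity>" using \<open>compact ?C\<close> by (rule emeasure_compact_finite)
  finally show ?thesis .
qed

lemma left_haar_measure_SL2_haar: "left_haar_measure SL2R SL2R_top SL2_haar"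
  unfolding left_haar_measure_def
proof (intro conjI ballI allI impI)
  show "space SL2_haar = topspace SL2R_top"
    by (simp add: SL2_haar_def space_restrict_space)
  have "sets SL2_haar = (\<inter>) {g. det g = 1} ` sigma_sets UNIV {S. open S}"
    by (simp add: sets_SL2_haar sets_restrict_space borel_def)
  also have "\<dots> = sigma_sets {g. det g = 1} ((\<inter>) {g. det g = 1} ` {S. open S})"
    using SL2_borel by (intro sigma_sets_Int) (auto simp: borel_def)
  also have "(\<inter>) {g. det g = 1} ` {S. open S} = {U. openin SL2R_top U}"
    by (auto simp: SL2R_top_def carrier_SL2R openin_open)
  finally show "sets SL2_haar = sigma_sets (topspace SL2R_top) {U. openin SL2R_top U}" by simp
next
  fix g A assume "g \<in> carrier SL2R" "A \<in> sets SL2_haar"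
  then show "emeasure SL2_haar (g <#\<^bsub>SL2R\<^esub> A) = emeasure SL2_haar A"
    by (simp add: l_coset_SL2R carrier_SL2R SL2_haar_left_invariant)
next
  fix K assume "compactin SL2R_top K"
  then show "emeasure SL2_haar K < \<infinity>"
    by (intro SL2_haar_bounded_finite) (auto simp: compactin_SL2R_top in_sets_SL2_haar compact_imp_bounded compact_imp_closed)
next
  let ?U = "{x. 0 < det_columns x \<and> det_columns x < 1}"
  have sp: "space SL2_haar = {g. det g = 1}" by (simp add: SL2_haar_def space_restrict_space)
  have "open ?U" 
    by (intro open_Collect_conj open_Collect_less continuous_intros)
  moreover have "(vector [1/2, 0], vector [0, 1]) \<in> ?U" by (simp add: det_columns_def)
  ultimately have "emeasure lborel ?U \<noteq> 0"
    using open_not_negligible[of ?U] by (auto simp: negligible_iff_null_sets null_sets_def)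
  moreover have "?U \<subseteq> {x \<in> det_cone. normalise x \<in> space SL2_haar}"
    by (auto simp: det_cone_def sp det_normalise)
  then have "emeasure lborel ?U \<le> emeasure SL2_haar (space SL2_haar)"
    using emeasure_SL2_haar[of "space SL2_haar"] by (auto intro!: emeasure_mono)
  ultimately show "emeasure SL2_haar (space SL2_haar) \<noteq> 0" by auto
qed

section \<open>A criterion for cocompact lattices\<close>

lemma open_translate:
  fixes U :: "(real^2^2) set"
  assumes "det g = 1" "open U"
  shows "open ((**) g ` U)"
proof -
  have "(**) g ` U = (**) (adj2 g) -` U"
    using assms by (auto simp: adj2_cancel intro!: image_eqI[of _ _ "adj2 g ** _"])
  then show ?thesis
    using assms by (simp add: open_vimage continuous_on_left_mult)
qed

text \<open>Discreteness is stated by a neighbourhood of the identity in the space of all matrices.\<close>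

locale discrete_SL2R_subgroup =
  fixes \<Gamma> :: "(real^2^2) set" and V :: "(real^2^2) set"
  assumes subgroup: "subgroup \<Gamma> SL2R"
    and V: "open V" "mat 1 \<in> V" "V \<inter> \<Gamma> \<subseteq> {mat 1}"
begin

lemma det_\<Gamma>: "\<gamma> \<in> \<Gamma> \<Longrightarrow> det \<gamma> = 1"
  using subgroup.subset[OF subgroup] by (auto simp: carrier_SL2R)

lemma mult_\<Gamma>: "\<gamma> \<in> \<Gamma> \<Longrightarrow> \<delta> \<in> \<Gamma> \<Longrightarrow> \<gamma> ** \<delta> \<in> \<Gamma>"
  using subgroup.m_closed[OF subgroup] by (simp add: mult_SL2R)

lemma adj2_\<Gamma>: "\<gamma> \<in> \<Gamma> \<Longrightarrow> adj2 \<gamma> \<in> \<Gamma>"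
  using subgroup.m_inv_closed[OF subgroup, of \<gamma>] inv_SL2R[of \<gamma>] det_\<Gamma>[of \<gamma>] by (simp add: carrier_SL2R)

lemma one_\<Gamma>: "mat 1 \<in> \<Gamma>"
  using subgroup.one_closed[OF subgroup] by (simp add: one_SL2R)

text \<open>Translating \<open>V\<close> by \<open>\<gamma>\<close> isolates \<open>\<gamma>\<close>.\<close>

lemma discrete: "discrete_subgroup SL2R SL2R_top \<Gamma>"
proof -
  have "{g. det g = 1} \<inter> \<Gamma> = \<Gamma>" using det_\<Gamma> by auto
  then have top: "subtopology SL2R_top \<Gamma> = top_of_set \<Gamma>"
    by (simp add: SL2R_top_def carrier_SL2R subtopology_subtopology)
  have "openin (top_of_set \<Gamma>) {\<gamma>}" if "\<gamma> \<in> \<Gamma>" for \<gamma>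
  proof -
    have "g = \<gamma>" if "g \<in> \<Gamma>" "adj2 \<gamma> ** g \<in> V" for g
    proof -
      have "adj2 \<gamma> ** g = mat 1" using V that mult_\<Gamma> adj2_\<Gamma> \<open>\<gamma> \<in> \<Gamma>\<close> by blast
      then have "\<gamma> ** (adj2 \<gamma> ** g) = \<gamma>" by simp
      then show ?thesis using det_\<Gamma>[OF \<open>\<gamma> \<in> \<Gamma>\<close>] by (simp add: adj2_cancel)
    qed
    then have "{\<gamma>} = \<Gamma> \<inter> (\<lambda>g. adj2 \<gamma> ** g) -` V"
      using that V det_\<Gamma>[OF that] by (auto simp: adj2_mult)
    then show ?thesis
      using V open_vimage[OF _ continuous_on_left_mult, of V "adj2 \<gamma>"] by (auto simp: openin_open)
  qed
  then have "discrete_topology \<Gamma> = top_of_set \<Gamma>"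
    by (subst discrete_topology_unique) auto
  then show ?thesis using subgroup top by (simp add: discrete_subgroup_def)
qed

text \<open>Sets that inject into the quotient by \<open>\<Gamma>\<close>.\<close>

definition embedded :: "(real^2^2) set \<Rightarrow> bool" where
  "embedded U \<longleftrightarrow> (\<forall>\<gamma>\<in>\<Gamma>. \<forall>x\<in>U. \<gamma> ** x \<in> U \<longrightarrow> \<gamma> = mat 1)"

text \<open>By continuity of \<open>(x, y) \<mapsto> x y\<inverse>\<close> at \<open>(k, k)\<close>, quotients of points near \<open>k\<close> lie in \<open>V\<close>.\<close>

lemma embedded_ball:
  assumes "det k = 1"
  obtains e where "0 < e" "embedded (ball k e \<inter> {g. det g = 1})"
proof -
  let ?f = "\<lambda>(x :: real^2^2, y). x ** adj2 y"
  have "open (?f -` V)"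
    using V by (intro open_vimage) (auto simp: case_prod_unfold intro!: continuous_intros)
  moreover have "(k, k) \<in> ?f -` V" using V assms by (simp add: adj2_mult)
  ultimately obtain A B where AB: "open A" "open B" "k \<in> A" "k \<in> B" "A \<times> B \<subseteq> ?f -` V"
    by (auto elim!: open_prod_elim)
  then have "open (A \<inter> B)" "k \<in> A \<inter> B" by auto
  then obtain e where e: "0 < e" "ball k e \<subseteq> A \<inter> B" using open_contains_ball by blast
  have "embedded (ball k e \<inter> {g. det g = 1})"
    unfolding embedded_def
  proof (intro ballI impI)
    fix \<gamma> x assume \<gamma>: "\<gamma> \<in> \<Gamma>" and x: "x \<in> ball k e \<inter> {g. det g = 1}" and gx: "\<gamma> ** x \<in> ball k e \<inter> {g. det g = 1}"
    have "(\<gamma> ** x, x) \<in> A \<times> B" using x gx e by blast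
    then have "(\<gamma> ** x) ** adj2 x \<in> V" using AB by auto
    moreover have "(\<gamma> ** x) ** adj2 x = \<gamma>"
      using x by (simp add: adj2_mult flip: matrix_mul_assoc)
    ultimately show "\<gamma> = mat 1" using V \<gamma> by auto
  qed
  then show ?thesis using that e by blast
qed

abbreviation saturation :: "(real^2^2) set \<Rightarrow> (real^2^2) set" where
  "saturation F \<equiv> \<Union>\<gamma>\<in>\<Gamma>. (**) \<gamma> ` F"

lemma translate_in_saturation:
  assumes "\<gamma> \<in> \<Gamma>" 
  shows "\<gamma> ** x \<in> saturation F \<longleftrightarrow> x \<in> saturation F"
proof
  assume "\<gamma> ** x \<in> saturation F"
  then obtain \<delta> f where *: "\<delta> \<in> \<Gamma>" "f \<in> F" "\<gamma> ** x = \<delta> ** f" by auto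
  have "x = adj2 \<gamma> ** (\<gamma> ** x)" using det_\<Gamma>[OF assms] by (simp add: adj2_cancel)
  then have "x = (adj2 \<gamma> ** \<delta>) ** f" unfolding *(3) by (simp add: matrix_mul_assoc)
  moreover have "adj2 \<gamma> ** \<delta> \<in> \<Gamma>" using assms * mult_\<Gamma> adj2_\<Gamma> by blast
  ultimately show "x \<in> saturation F" using *(2) by blast
next
  assume "x \<in> saturation F"
  then obtain \<delta> f where *: "\<delta> \<in> \<Gamma>" "f \<in> F" "x = \<delta> ** f" by auto
  then have "\<gamma> ** x = (\<gamma> ** \<delta>) ** f" by (simp add: matrix_mul_assoc)
  moreover have "\<gamma> ** \<delta> \<in> \<Gamma>" using assms * mult_\<Gamma> by blast
  ultimately show "\<gamma> ** x \<in> saturation F" using *(2) by blast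
qed

lemma saturation_subset: "F \<subseteq> saturation F"
proof
  fix x assume "x \<in> F"
  then have "x \<in> (**) (mat 1) ` F" by simp
  then show "x \<in> saturation F" using one_\<Gamma> by blast
qed

text \<open>The sets are added one at a time, and from each new set the \<open>\<Gamma>\<close>-orbits that have been met
  before are removed. These form an open set, so the result stays Borel.\<close>

lemma embedded_refinement:
  assumes "finite \<U>" "\<And>U. U \<in> \<U> \<Longrightarrow> open U \<and> embedded (U \<inter> {g. det g = 1})"
  shows "\<exists>F. F \<in> sets borel \<and> F \<subseteq> \<Union>\<U> \<inter> {g. det g = 1} \<and> embedded F \<and> \<Union>\<U> \<inter> {g. det g = 1} \<subseteq> saturation F"
  using assms
proof (induction \<U>)
  case empty
  then show ?case by (auto simp: embedded_def)
next
  case (insert U \<U>)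
  let ?G = "{g :: real^2^2. det g = 1}"
  obtain F where F: "F \<in> sets borel" "F \<subseteq> \<Union>\<U> \<inter> ?G" "embedded F" "\<Union>\<U> \<inter> ?G \<subseteq> saturation F"
    using insert by blast
  have U: "open U" "embedded (U \<inter> ?G)" using insert.prems by auto
  \<comment> \<open>The removed set is the saturation of the open sets, which is open. Inside the group it
    agrees with that of \<open>F\<close>.\<close>
  define W where "W = saturation (\<Union>\<U>)"
  have W: "open W"
    unfolding W_def using insert.prems det_\<Gamma> by (intro open_UN ballI open_translate open_Union) auto
  have WF: "x \<in> W \<longleftrightarrow> x \<in> saturation F" if "x \<in> ?G" for x
  proof
    assume "x \<in> saturation F"
    then show "x \<in> W" using F(2) unfolding W_def by blast
  next
    assume "x \<in> W"
    then obtain \<gamma> y where y: "\<gamma> \<in> \<Gamma>" "y \<in> \<Union>\<U>" "x = \<gamma> ** y" unfolding W_def by blast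
    then have "det y = 1" using that det_\<Gamma> by (auto simp: det_mul)
    then have "y \<in> saturation F" using y(2) F(4) by blast
    then show "x \<in> saturation F" unfolding y(3) using translate_in_saturation[OF y(1)] by simp
  qed
  let ?F = "F \<union> (U \<inter> ?G - W)"
  have "embedded ?F"
    unfolding embedded_def
  proof (intro ballI impI)
    fix \<gamma> x assume \<gamma>: "\<gamma> \<in> \<Gamma>" and x: "x \<in> ?F" and gx: "\<gamma> ** x \<in> ?F"
    have *: "y \<in> F \<longleftrightarrow> y \<in> saturation F" if "y \<in> ?F" for y
    proof
      show "y \<in> F \<Longrightarrow> y \<in> saturation F" using saturation_subset[of F] by (rule subsetD)
      assume "y \<in> saturation F"
      then have "y \<in> W" if "y \<in> ?G" using WF[OF that] by simp
      then show "y \<in> F" using that by auto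
    qed
    have "x \<in> F \<longleftrightarrow> \<gamma> ** x \<in> F"
      using *[OF x] *[OF gx] translate_in_saturation[OF \<gamma>] by simp
    then show "\<gamma> = mat 1"
      using x gx F(3) U(2) \<gamma> unfolding embedded_def by blast
  qed
  moreover have "?F \<in> sets borel"
    using F(1) W U(1) SL2_borel by auto
  moreover have "?F \<subseteq> \<Union>(insert U \<U>) \<inter> ?G" using F(2) by blast
  moreover have "\<Union>(insert U \<U>) \<inter> ?G \<subseteq> saturation ?F"
  proof
    fix x assume x: "x \<in> \<Union>(insert U \<U>) \<inter> ?G"
    have mono: "saturation F \<subseteq> saturation ?F" by (intro UN_mono image_mono) auto
    show "x \<in> saturation ?F"
    proof (cases "x \<in> W")
      case True
      then have "x \<in> saturation F" using WF[of x] x by simp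
      then show ?thesis using mono by (rule set_mp[rotated])
    next
      case False
      then have "x \<notin> \<Union>\<U>"
        using saturation_subset[of "\<Union>\<U>"] unfolding W_def by (meson subsetD)
      then have "x \<in> ?F" using x False by blast
      then show ?thesis using saturation_subset[of ?F] by (rule set_mp[rotated])
    qed
  qed
  ultimately show ?case by blast
qed

text \<open>An infinite bounded subset would accumulate at some point \<open>l\<close> of \<open>SL\<^sub>2(\<real>)\<close>, and a
  neighbourhood of \<open>l\<close> that injects into the quotient would contain two different elements of
  \<open>\<Gamma>\<close>.\<close>

lemma bounded_subset_finite:
  assumes "S \<subseteq> \<Gamma>" "bounded S"
  shows "finite S"
proof (rule ccontr)
  let ?G = "{g :: real^2^2. det g = 1}"
  assume "infinite S"
  have SG: "S \<subseteq> ?G" using assms(1) det_\<Gamma> by auto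
  have "compact (closure S)" using assms(2) by simp
  then obtain l where l: "l islimpt S"
    using \<open>infinite S\<close> closure_subset[of S] unfolding compact_eq_Bolzano_Weierstrass by blast
  then have "l \<in> closure S" by (simp add: closure_def)
  then have "det l = 1" using closure_minimal[OF SG closed_SL2] by blast
  then obtain e where e: "0 < e" "embedded (ball l e \<inter> ?G)" by (rule embedded_ball)
  have "infinite (S \<inter> ball l e)"
    using l e(1) unfolding islimpt_eq_infinite_ball by simp
  then obtain x where x: "x \<in> S \<inter> ball l e" using infinite_imp_nonempty by blast
  have "infinite (S \<inter> ball l e - {x})" using \<open>infinite (S \<inter> ball l e)\<close> by simp
  then obtain y where y: "y \<in> S \<inter> ball l e" "y \<noteq> x" using infinite_imp_nonempty by blast
  have dx: "det x = 1" using x SG by auto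
  have "(y ** adj2 x) ** x = y" using dx by (simp add: adj2_mult flip: matrix_mul_assoc)
  moreover have "y ** adj2 x \<in> \<Gamma>" using x y assms(1) mult_\<Gamma> adj2_\<Gamma> by blast
  moreover have "x \<in> ball l e \<inter> ?G" "y \<in> ball l e \<inter> ?G" using x y(1) SG by auto
  ultimately have "y ** adj2 x = mat 1"
    using e(2)[unfolded embedded_def, rule_format, of "y ** adj2 x" x] by simp
  then show False using \<open>(y ** adj2 x) ** x = y\<close> y(2) by simp
qed

end

locale uniform_SL2R_subgroup = discrete_SL2R_subgroup +
  fixes K :: "(real^2^2) set"
  assumes K: "compact K" "K \<subseteq> {g. det g = 1}"
    and covering: "det g = 1 \<Longrightarrow> \<exists>\<gamma>\<in>\<Gamma>. \<gamma> ** g \<in> K"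
begin

text \<open>The quotient is the image of \<open>K\<close> under the projection.\<close>

lemma cocompact: "cocompact SL2R SL2R_top \<Gamma>"
proof -
  let ?q = "\<lambda>g. \<Gamma> #>\<^bsub>SL2R\<^esub> g"
  let ?Q = "coset_space SL2R SL2R_top \<Gamma>"
  have r: "rcosets\<^bsub>SL2R\<^esub> \<Gamma> = ?q ` {g. det g = 1}"
    by (auto simp: RCOSETS_def carrier_SL2R)
  have "openin ?Q (rcosets\<^bsub>SL2R\<^esub> \<Gamma>)"
    using openin_topspace[of SL2R_top] by (auto simp: openin_coset_space r cong: conj_cong)
  moreover have "topspace ?Q \<subseteq> rcosets\<^bsub>SL2R\<^esub> \<Gamma>"
    using openin_topspace[of ?Q] unfolding openin_coset_space by blast
  ultimately have top: "topspace ?Q = rcosets\<^bsub>SL2R\<^esub> \<Gamma>"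
    using openin_subset by blast
  have cont: "continuous_map SL2R_top ?Q ?q"
    by (auto simp: continuous_map_def top r openin_coset_space)
  have eq: "?q (\<gamma> ** g) = ?q g" if "\<gamma> \<in> \<Gamma>" "det g = 1" for \<gamma> g
  proof -
    have "?q (\<gamma> ** g) = (\<Gamma> #>\<^bsub>SL2R\<^esub> \<gamma>) #>\<^bsub>SL2R\<^esub> g"
      using group.coset_mult_assoc[OF group_SL2R, of \<Gamma> \<gamma> g] that det_\<Gamma> subgroup.subset[OF subgroup]
      by (auto simp: mult_SL2R carrier_SL2R)
    also have "\<Gamma> #>\<^bsub>SL2R\<^esub> \<gamma> = \<Gamma>"
      using group.coset_join2[OF group_SL2R _ subgroup] that det_\<Gamma> by (simp add: carrier_SL2R)
    finally show ?thesis .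
  qed
  have "rcosets\<^bsub>SL2R\<^esub> \<Gamma> \<subseteq> ?q ` K"
  proof
    fix c assume "c \<in> rcosets\<^bsub>SL2R\<^esub> \<Gamma>"
    then obtain g where g: "c = ?q g" "det g = 1" unfolding r by auto
    then obtain \<gamma> where "\<gamma> \<in> \<Gamma>" "\<gamma> ** g \<in> K" using covering by blast
    then show "c \<in> ?q ` K" using eq[of \<gamma> g] g by auto
  qed
  then have "?q ` K = topspace ?Q" using K unfolding top r by auto
  moreover have "compactin ?Q (?q ` K)"
    using image_compactin[OF _ cont] K by (simp add: compactin_SL2R_top)
  ultimately show ?thesis by (simp add: cocompact_def compact_space_def)
qed

text \<open>Finitely many balls that inject into the quotient cover \<open>K\<close>. Refining them gives a bounded
  Borel set.\<close>

lemma fundamental_set_exists: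
  obtains F where "F \<in> sets SL2_haar" "fundamental_set SL2R \<Gamma> F" "emeasure SL2_haar F < \<infinity>"
proof -
  let ?G = "{g :: real^2^2. det g = 1}"
  have "\<forall>k\<in>K. \<exists>e>0. embedded (ball k e \<inter> ?G)" using embedded_ball K by blast
  then obtain e where e: "\<And>k. k \<in> K \<Longrightarrow> 0 < e k \<and> embedded (ball k (e k) \<inter> ?G)" by metis
  obtain C where C: "C \<subseteq> K" "finite C" "K \<subseteq> (\<Union>k\<in>C. ball k (e k))"
  proof (rule compactE_image[OF K(1), of K "\<lambda>k. ball k (e k)"])
    show "K \<subseteq> (\<Union>k\<in>K. ball k (e k))"
    proof
      fix k assume "k \<in> K"
      then show "k \<in> (\<Union>k\<in>K. ball k (e k))" using e[of k] by (intro UN_I[of k]) auto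
    qed
  qed (use that in auto)
  let ?U = "(\<lambda>k. ball k (e k)) ` C"
  have "\<exists>F. F \<in> sets borel \<and> F \<subseteq> \<Union>?U \<inter> ?G \<and> embedded F \<and> \<Union>?U \<inter> ?G \<subseteq> saturation F"
    using C e by (intro embedded_refinement) auto
  then obtain F where F: "F \<in> sets borel" "F \<subseteq> \<Union>?U \<inter> ?G" "embedded F" "\<Union>?U \<inter> ?G \<subseteq> saturation F"
    by blast
  have F_sets: "F \<in> sets SL2_haar" using F by (auto simp: in_sets_SL2_haar)
  have "bounded (\<Union>?U)" using C by (intro bounded_Union) auto
  then have "bounded F" using F(2) bounded_subset by blast
  moreover have "fundamental_set SL2R \<Gamma> F"
    unfolding fundamental_set_def l_coset_SL2R carrier_SL2R
  proof (intro conjI)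
    show "F \<subseteq> ?G" using F by blast
    show "saturation F = ?G"
    proof
      show "saturation F \<subseteq> ?G" using F(2) det_\<Gamma> by (auto simp: det_mul)
      show "?G \<subseteq> saturation F"
      proof
        fix g :: "real^2^2" assume g: "g \<in> ?G"
        then obtain \<gamma> where "\<gamma> \<in> \<Gamma>" "\<gamma> ** g \<in> K" using covering by blast
        then have "\<gamma> ** g \<in> \<Union>?U \<inter> ?G" using C(3) K(2) by blast
        then have "\<gamma> ** g \<in> saturation F" using F(4) by (rule set_mp[rotated])
        then show "g \<in> saturation F" using translate_in_saturation[OF \<open>\<gamma> \<in> \<Gamma>\<close>] by simp
      qed
    qed
    show "disjoint_family_on (\<lambda>\<gamma>. (**) \<gamma> ` F) \<Gamma>"
      unfolding disjoint_family_on_def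
    proof (intro ballI impI equals0I)
      fix \<gamma> \<delta> x assume \<gamma>: "\<gamma> \<in> \<Gamma>" and \<delta>: "\<delta> \<in> \<Gamma>" and "\<gamma> \<noteq> \<delta>" and "x \<in> (**) \<gamma> ` F \<inter> (**) \<delta> ` F"
      then obtain y z where yz: "y \<in> F" "z \<in> F" "\<gamma> ** y = \<delta> ** z" by auto
      then have "adj2 \<delta> ** (\<gamma> ** y) = z" using det_\<Gamma>[OF \<delta>] by (simp add: adj2_cancel)
      moreover have "adj2 \<delta> ** (\<gamma> ** y) = (adj2 \<delta> ** \<gamma>) ** y" by (simp add: matrix_mul_assoc)
      ultimately have "(adj2 \<delta> ** \<gamma>) ** y \<in> F" using yz(2) by simp
      then have "adj2 \<delta> ** \<gamma> = mat 1"
        using F(3) yz(1) mult_\<Gamma>[OF adj2_\<Gamma>[OF \<delta>] \<gamma>] unfolding embedded_def by blast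
      then have "\<delta> ** (adj2 \<delta> ** \<gamma>) = \<delta>" by simp
      then show False using det_\<Gamma>[OF \<delta>] \<open>\<gamma> \<noteq> \<delta>\<close> by (simp add: adj2_cancel)
    qed
  qed
  ultimately show ?thesis using that F_sets SL2_haar_bounded_finite by blast
qed

theorem cocompact_lattice:
  "lattice_subgroup SL2R SL2R_top \<Gamma> \<and> cocompact SL2R SL2R_top \<Gamma>"
  unfolding lattice_subgroup_def
  using discrete cocompact left_haar_measure_SL2_haar fundamental_set_exists by metis

end

section \<open>The hyperboloid model\<close>

abbreviation \<H> where "\<H> \<equiv> upper_half_plane"

lemma in_\<H> [simp]: "z \<in> \<H> \<longleftrightarrow> 0 < Im z"
  by (simp add: upper_half_plane_def)

text \<open>The hyperboloid model: in the coordinates \<open>(A, b, C)\<close> of a symmetric matrix, the image of the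
  upper half plane is the sheet \<open>A C - b\<^sup>2 = 1\<close>, \<open>C > 0\<close>.\<close>

definition hvec :: "complex \<Rightarrow> real^3" where
  "hvec z = vector [((Re z)\<^sup>2 + (Im z)\<^sup>2) / Im z, Re z / Im z, 1 / Im z]"

text \<open>The Lorentz form on functionals, normalised such that geodesics correspond to functionals of
  square \<open>1\<close>. On \<open>\<alpha> \<bar>z\<bar>\<^sup>2 + \<beta> Re z + \<gamma>\<close> the square is the discriminant \<open>\<beta>\<^sup>2 - 4 \<alpha> \<gamma>\<close>.\<close>

definition lorentz :: "real^3 \<Rightarrow> real^3 \<Rightarrow> real" where
  "lorentz u v = u$2 * v$2 - 2 * u$1 * v$3 - 2 * u$3 * v$1"

abbreviation level :: "real^3 \<Rightarrow> complex \<Rightarrow> real" where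
  "level w z \<equiv> w \<bullet> hvec z"

definition mirror :: "real^3 \<Rightarrow> complex set" where
  "mirror w = {z \<in> \<H>. level w z = 0}"

definition geodesic_poly :: "real^3 \<Rightarrow> complex \<Rightarrow> real" where
  "geodesic_poly w z = w$1 * ((Re z)\<^sup>2 + (Im z)\<^sup>2) + w$2 * Re z + w$3"

lemma level_geodesic_poly: "level w z = geodesic_poly w z / Im z"
  by (simp add: hvec_def geodesic_poly_def inner_vec_def sum_3 flip: add_divide_distrib)

lemma level_eq_0_iff: "0 < Im z \<Longrightarrow> level w z = 0 \<longleftrightarrow> geodesic_poly w z = 0"
  by (simp add: level_geodesic_poly)

lemma level_pos_iff: "0 < Im z \<Longrightarrow> 0 < level w z \<longleftrightarrow> 0 < geodesic_poly w z"
  by (simp add: level_geodesic_poly zero_less_divide_iff)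

lemma hvec_nth [simp]:
  "hvec z $ 1 = ((Re z)\<^sup>2 + (Im z)\<^sup>2) / Im z" "hvec z $ 2 = Re z / Im z" "hvec z $ 3 = 1 / Im z"
  by (simp_all add: hvec_def)

lemma hvec_inject: "0 < Im z \<Longrightarrow> 0 < Im z' \<Longrightarrow> hvec z = hvec z' \<longleftrightarrow> z = z'"
  by (auto simp: vec_eq_iff forall_3 complex_eq_iff)

lemma hvec_det: "0 < Im z \<Longrightarrow> hvec z $ 1 * hvec z $ 3 - (hvec z $ 2)\<^sup>2 = 1"
  by (simp add: field_simps power2_eq_square)

text \<open>A ray meets the sheet of the hyperboloid at most once.\<close>

lemma hvec_not_parallel:
  assumes "0 < Im p" "0 < Im q" "hvec q = k *\<^sub>R hvec p"
  shows "p = q"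
proof -
  have k: "1 / Im q = k * (1 / Im p)" using assms(3) hvec_nth(3) by (metis vector_scaleR_component real_scaleR_def)
  then have "0 < k" using assms by (metis divide_pos_pos zero_less_mult_pos2 zero_less_one)
  have q: "hvec q $ i = k * hvec p $ i" for i by (simp add: assms(3))
  have "1 = hvec q $ 1 * hvec q $ 3 - (hvec q $ 2)\<^sup>2" by (rule hvec_det[OF assms(2), symmetric])
  also have "\<dots> = k\<^sup>2 * (hvec p $ 1 * hvec p $ 3 - (hvec p $ 2)\<^sup>2)"
    unfolding q by (simp add: algebra_simps power2_eq_square del: hvec_nth)
  finally have "1 = k\<^sup>2 * (hvec p $ 1 * hvec p $ 3 - (hvec p $ 2)\<^sup>2)" .
  then have "k\<^sup>2 = 1" using hvec_det[OF assms(1)] by simp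
  then have "k = 1" using \<open>0 < k\<close> by (simp add: power2_eq_1_iff)
  then show ?thesis using assms hvec_inject by auto
qed

text \<open>On a geodesic, the discriminant is the squared length of the gradient of its equation. In
  particular it is nonnegative as soon as the functional has a zero in the upper half plane.\<close>

lemma geodesic_poly_discriminant:
  assumes "geodesic_poly w z = 0"
  shows "lorentz w w = (2 * w$1 * Re z + w$2)\<^sup>2 + (2 * w$1 * Im z)\<^sup>2"
proof -
  have "(2 * w$1 * Re z + w$2)\<^sup>2 + (2 * w$1 * Im z)\<^sup>2 = lorentz w w + 4 * w$1 * geodesic_poly w z"
    by (simp add: geodesic_poly_def lorentz_def power2_eq_square algebra_simps)
  then show ?thesis using assms by simp
qed

section \<open>Geodesics as zero sets of linear functionals\<close>

lemma geodesic_iff_mirror: "l \<in> geodesics \<longleftrightarrow> (\<exists>w. lorentz w w = 1 \<and> l = mirror w)"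
proof
  assume "l \<in> geodesics"
  then consider a where "l = {z \<in> \<H>. Re z = a}" | a r where "r > 0" "l = {z \<in> \<H>. cmod (z - of_real a) = r}"
    unfolding geodesics_def by auto
  then show "\<exists>w. lorentz w w = 1 \<and> l = mirror w"
  proof cases
    case 1
    then show ?thesis
      by (intro exI[of _ "vector [0, 1, - a]"])
        (auto simp: mirror_def lorentz_def level_eq_0_iff geodesic_poly_def)
  next
    case 2
    let ?w = "vector [1 / (2 * r), - a / r, (a\<^sup>2 - r\<^sup>2) / (2 * r)] :: real^3"
    have eq: "cmod (z - of_real a) = r \<longleftrightarrow> geodesic_poly ?w z = 0" for z
    proof -
      have "cmod (z - of_real a) = r \<longleftrightarrow> (cmod (z - of_real a))\<^sup>2 = r\<^sup>2"
        using 2 by (simp add: power2_eq_iff_nonneg)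
      also have "\<dots> \<longleftrightarrow> (Re z - a)\<^sup>2 + (Im z)\<^sup>2 - r\<^sup>2 = 0"
        by (simp add: cmod_power2)
      also have "(Re z - a)\<^sup>2 + (Im z)\<^sup>2 - r\<^sup>2 = 2 * r * geodesic_poly ?w z"
        using 2 by (simp add: geodesic_poly_def field_simps power2_eq_square)
      finally show ?thesis using 2 by simp
    qed
    have "l = mirror ?w"
      unfolding 2(2) mirror_def by (rule Collect_cong) (simp add: eq level_eq_0_iff cong: conj_cong)
    moreover have "lorentz ?w ?w = 1"
      using 2 by (simp add: lorentz_def field_simps power2_eq_square)
    ultimately show ?thesis by blast
  qed
next
  assume "\<exists>w. lorentz w w = 1 \<and> l = mirror w"
  then obtain w where w: "lorentz w w = 1" "l = mirror w" by blast
  show "l \<in> geodesics"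
  proof (cases "w$1 = 0")
    case True
    then have "w$2 \<noteq> 0" using w by (auto simp: lorentz_def)
    then have "l = {z \<in> \<H>. Re z = - w$3 / w$2}"
      using True w by (auto simp: mirror_def level_eq_0_iff geodesic_poly_def field_simps)
    then show ?thesis unfolding geodesics_def by blast
  next
    case False
    let ?a = "- w$2 / (2 * w$1)" and ?r = "1 / (2 * \<bar>w$1\<bar>)"
    have eq: "cmod (z - of_real ?a) = ?r \<longleftrightarrow> geodesic_poly w z = 0" for z
    proof -
      have "cmod (z - of_real ?a) = ?r \<longleftrightarrow> (cmod (z - of_real ?a))\<^sup>2 = ?r\<^sup>2"
        by (subst power2_eq_iff_nonneg) auto
      also have "\<dots> \<longleftrightarrow> (Re z - ?a)\<^sup>2 + (Im z)\<^sup>2 - ?r\<^sup>2 = 0"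
        by (simp add: cmod_power2)
      also have "?r\<^sup>2 = lorentz w w / (4 * (w$1)\<^sup>2)"
        using w by (simp add: power_divide power_mult_distrib)
      also have "(Re z - ?a)\<^sup>2 + (Im z)\<^sup>2 - lorentz w w / (4 * (w$1)\<^sup>2) = geodesic_poly w z / w$1"
        using False by (simp add: geodesic_poly_def lorentz_def field_simps power2_eq_square)
      finally show ?thesis using False by simp
    qed
    have "l = {z \<in> \<H>. cmod (z - of_real ?a) = ?r}"
      unfolding w(2) mirror_def eq by (rule Collect_cong) (simp add: level_eq_0_iff cong: conj_cong)
    moreover have "?r > 0" using False by simp
    ultimately show ?thesis unfolding geodesics_def by blast
  qed
qed

lemma cross_hvec_nonzero:
  assumes "p \<noteq> q" "0 < Im p" "0 < Im q"
  shows "cross3 (hvec p) (hvec q) \<noteq> 0"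
proof
  assume "cross3 (hvec p) (hvec q) = 0"
  then have "collinear {0, hvec p, hvec q}" by (simp add: cross_eq_0)
  then have "hvec p = 0 \<or> hvec q = 0 \<or> (\<exists>k. hvec q = k *\<^sub>R hvec p)" by (simp add: collinear_lemma)
  moreover have "hvec z \<noteq> 0" if "0 < Im z" for z
    using that hvec_nth(3)[of z] by (metis less_irrefl zero_index zero_less_divide_1_iff)
  ultimately show False using hvec_not_parallel assms by blast
qed

lemma functional_parallel_cross:
  assumes "p \<noteq> q" "0 < Im p" "0 < Im q" "level w p = 0" "level w q = 0"
  obtains k where "w = k *\<^sub>R cross3 (hvec p) (hvec q)"
proof -
  let ?c = "cross3 (hvec p) (hvec q)"
  have "cross3 w ?c = 0"
    using assms by (simp add: Lagrange)
  then have "collinear {0, ?c, w}" by (simp add: cross_eq_0 insert_commute)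
  then have "?c = 0 \<or> w = 0 \<or> (\<exists>k. w = k *\<^sub>R ?c)" by (simp add: collinear_lemma)
  moreover have "?c \<noteq> 0" using assms by (intro cross_hvec_nonzero)
  ultimately show ?thesis using that by (metis scaleR_zero_left)
qed

text \<open>Two points span a plane in \<open>\<real>\<^sup>3\<close>, so the functionals vanishing at both are multiples of the
  cross product, and the normalisation leaves only the sign.\<close>

lemma functional_unique:
  assumes "p \<noteq> q" "p \<in> mirror w" "q \<in> mirror w" "p \<in> mirror w'" "q \<in> mirror w'"
    and "lorentz w w = 1" "lorentz w' w' = 1"
  shows "w' = w \<or> w' = - w"
proof -
  let ?c = "cross3 (hvec p) (hvec q)"
  have pq: "0 < Im p" "0 < Im q" "level w p = 0" "level w q = 0" "level w' p = 0" "level w' q = 0"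
    using assms by (simp_all add: mirror_def)
  obtain k where "w = k *\<^sub>R ?c"
    using functional_parallel_cross[OF assms(1) pq(1,2,3,4)] .
  moreover obtain k' where "w' = k' *\<^sub>R ?c"
    using functional_parallel_cross[OF assms(1) pq(1,2,5,6)] .
  ultimately have k: "w = k *\<^sub>R ?c" "w' = k' *\<^sub>R ?c" .
  have "lorentz w w = k\<^sup>2 * lorentz ?c ?c" "lorentz w' w' = k'\<^sup>2 * lorentz ?c ?c"
    unfolding k by (simp_all add: lorentz_def power2_eq_square algebra_simps)
  then have "k'\<^sup>2 = k\<^sup>2" using assms by (metis mult_cancel_right mult_zero_right zero_neq_one)
  then show ?thesis using k by (auto simp: power2_eq_iff)
qed

lemma functional_exists:
  assumes "p \<noteq> q" "0 < Im p" "0 < Im q"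
  obtains w where "lorentz w w = 1" "p \<in> mirror w" "q \<in> mirror w"
proof -
  let ?c = "cross3 (hvec p) (hvec q)"
  have c: "level ?c p = 0" "level ?c q = 0" by (simp_all add: dot_cross_self)
  have "?c \<noteq> 0" using assms by (rule cross_hvec_nonzero)
  have g: "geodesic_poly ?c p = 0" using c level_eq_0_iff assms by blast
  have "lorentz ?c ?c \<noteq> 0"
  proof
    assume "lorentz ?c ?c = 0"
    then have "?c $ 1 = 0" "?c $ 2 = 0"
      using geodesic_poly_discriminant[OF g] assms by (auto simp: sum_power2_eq_zero_iff)
    then have "?c $ 3 = 0" using g by (simp add: geodesic_poly_def)
    then show False using \<open>?c $ 1 = 0\<close> \<open>?c $ 2 = 0\<close> \<open>?c \<noteq> 0\<close> by (simp add: vec_eq_iff forall_3)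
  qed
  then have pos: "0 < lorentz ?c ?c"
    using geodesic_poly_discriminant[OF g] by (metis order_le_less sum_power2_ge_zero)
  define r where "r = 1 / sqrt (lorentz ?c ?c)"
  have "lorentz (r *\<^sub>R ?c) (r *\<^sub>R ?c) = r\<^sup>2 * lorentz ?c ?c"
    by (simp add: lorentz_def power2_eq_square algebra_simps)
  also have "\<dots> = 1" using pos by (simp add: r_def power_divide)
  finally show ?thesis
    using that[of "r *\<^sub>R ?c"] c assms by (simp add: mirror_def)
qed

lemma geodesic_through_mirror:
  assumes "p \<noteq> q" "p \<in> mirror w" "q \<in> mirror w" "lorentz w w = 1"
  shows "geodesic_through p q = mirror w"
  unfolding geodesic_through_def
proof (rule the_equality)
  show "mirror w \<in> geodesics \<and> p \<in> mirror w \<and> q \<in> mirror w"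
    using assms geodesic_iff_mirror by blast
  fix l assume l: "l \<in> geodesics \<and> p \<in> l \<and> q \<in> l"
  then obtain w' where w': "lorentz w' w' = 1" "l = mirror w'" using geodesic_iff_mirror by blast
  then have "w' = w \<or> w' = - w" using functional_unique assms l by blast
  then show "l = mirror w" using w' by (auto simp: mirror_def)
qed

section \<open>Moebius transformations\<close>

definition mob :: "real^2^2 \<Rightarrow> complex \<Rightarrow> complex" where
  "mob g z = (of_real (g$1$1) * z + of_real (g$1$2)) / (of_real (g$2$1) * z + of_real (g$2$2))"

lemma moebius_transf_mob: "moebius_transf g = restrict (mob g) \<H>"
  by (simp add: moebius_transf_def mob_def moebius_def fun_eq_iff restrict_def)

lemma mob_denominator:
  fixes g :: "real^2^2"
  assumes "det g = 1" "0 < Im z"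
  shows "of_real (g$2$1) * z + of_real (g$2$2) \<noteq> 0"
proof
  assume *: "of_real (g$2$1) * z + of_real (g$2$2) = 0"
  then have "Im (of_real (g$2$1) * z + of_real (g$2$2)) = 0" "Re (of_real (g$2$1) * z + of_real (g$2$2)) = 0"
    by simp_all
  then have "g$2$1 = 0" "g$2$2 = 0" using assms by auto
  then show False using assms by (simp add: det_2)
qed

text \<open>Transformations act on the hyperboloid model by \<open>X \<mapsto> g X g\<^sup>T\<close>. The lemma gives the three
  entries of the product.\<close>

lemma mob_hvec:
  assumes "det g = 1" "0 < Im z"
  shows "0 < Im (mob g z)"
    and "hvec (mob g z) $ 1 = ((g$1$1 * Re z + g$1$2)\<^sup>2 + (g$1$1 * Im z)\<^sup>2) / Im z"
    and "hvec (mob g z) $ 2 = geodesic_poly (vector [g$1$1 * g$2$1, g$1$1 * g$2$2 + g$1$2 * g$2$1, g$1$2 * g$2$2]) z / Im z"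
    and "hvec (mob g z) $ 3 = ((g$2$1 * Re z + g$2$2)\<^sup>2 + (g$2$1 * Im z)\<^sup>2) / Im z"
proof -
  let ?n = "of_real (g$1$1) * z + of_real (g$1$2)" and ?d = "of_real (g$2$1) * z + of_real (g$2$2)"
  define D where "D = (g$2$1 * Re z + g$2$2)\<^sup>2 + (g$2$1 * Im z)\<^sup>2"
  have Dd: "D = (cmod ?d)\<^sup>2" by (simp add: D_def cmod_power2)
  have D: "0 < D" using mob_denominator[OF assms] by (simp add: Dd)
  have dt: "g$1$1 * g$2$2 = 1 + g$1$2 * g$2$1" using assms by (simp add: det_2)
  have "Im (mob g z) = (g$1$1 * g$2$2 - g$1$2 * g$2$1) * Im z / D"
    by (simp add: mob_def Im_divide D_def) (simp add: algebra_simps)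
  then have Im: "Im (mob g z) = Im z / D" using dt by simp
  have Re: "Re (mob g z) = geodesic_poly (vector [g$1$1 * g$2$1, g$1$1 * g$2$2 + g$1$2 * g$2$1, g$1$2 * g$2$2]) z / D"
    by (simp add: mob_def Re_divide D_def geodesic_poly_def) (simp add: algebra_simps power2_eq_square)
  have sq: "(Re (mob g z))\<^sup>2 + (Im (mob g z))\<^sup>2 = ((g$1$1 * Re z + g$1$2)\<^sup>2 + (g$1$1 * Im z)\<^sup>2) / D"
    unfolding cmod_power2[symmetric] mob_def norm_divide power_divide Dd[symmetric]
    by (simp add: cmod_power2)
  show "0 < Im (mob g z)" using D assms Im by simp
  show "hvec (mob g z) $ 1 = ((g$1$1 * Re z + g$1$2)\<^sup>2 + (g$1$1 * Im z)\<^sup>2) / Im z"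
    unfolding hvec_nth sq using D by (simp add: Im)
  show "hvec (mob g z) $ 2 = geodesic_poly (vector [g$1$1 * g$2$1, g$1$1 * g$2$2 + g$1$2 * g$2$1, g$1$2 * g$2$2]) z / Im z"
    using D by (simp add: Re Im)
  show "hvec (mob g z) $ 3 = ((g$2$1 * Re z + g$2$2)\<^sup>2 + (g$2$1 * Im z)\<^sup>2) / Im z"
    using D by (simp add: D_def[symmetric] Im)
qed

lemma mob_mult:
  assumes "det g = 1" "det h = 1" "0 < Im z"
  shows "mob (g ** h) z = mob g (mob h z)"
proof -
  let ?n = "of_real (h$1$1) * z + of_real (h$1$2)" and ?d = "of_real (h$2$1) * z + of_real (h$2$2)"
  have d: "?d \<noteq> 0" using mob_denominator assms by blast
  have h: "mob h z = ?n / ?d" by (simp add: mob_def)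
  have "mob g (?n / ?d) = (of_real (g$1$1) * ?n + of_real (g$1$2) * ?d) / (of_real (g$2$1) * ?n + of_real (g$2$2) * ?d)"
    using d by (simp add: mob_def divide_simps)
  also have "\<dots> = mob (g ** h) z"
    unfolding mob_def matrix_matrix_mult_def by (simp add: sum_2 algebra_simps)
  finally show ?thesis using h by simp
qed

lemma mob_one: "mob (mat 1) z = z"
  by (simp add: mob_def mat_def)

lemma BijGroup_mult: 
  "f \<in> carrier (BijGroup S) \<Longrightarrow> g \<in> carrier (BijGroup S) \<Longrightarrow> z \<in> S \<Longrightarrow> (f \<otimes>\<^bsub>BijGroup S\<^esub> g) z = f (g z)"
  by (simp add: BijGroup_def compose_def)

lemma BijGroup_one: "z \<in> S \<Longrightarrow> \<one>\<^bsub>BijGroup S\<^esub> z = z"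
  by (simp add: BijGroup_def)

lemma BijGroup_eqI:
  assumes "f \<in> carrier (BijGroup S)" "g \<in> carrier (BijGroup S)" "\<And>z. z \<in> S \<Longrightarrow> f z = g z"
  shows "f = g"
  using assms by (auto simp: BijGroup_def Bij_def intro: extensionalityI)

lemma BijGroup_maps: "f \<in> carrier (BijGroup S) \<Longrightarrow> z \<in> S \<Longrightarrow> f z \<in> S"
  by (auto simp: BijGroup_def Bij_def bij_betw_def)

lemma involution_in_BijGroup:
  assumes "\<And>z. z \<in> S \<Longrightarrow> f z \<in> S" "\<And>z. z \<in> S \<Longrightarrow> f (f z) = z"
  shows "restrict f S \<in> carrier (BijGroup S)"
proof -
  have "bij_betw (restrict f S) S S"
    by (rule bij_betw_byWitness[where f' = "restrict f S"]) (use assms in auto)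
  then show ?thesis by (simp add: BijGroup_def Bij_def)
qed

lemma moebius_transf_in_BijGroup:
  assumes "det g = 1"
  shows "moebius_transf g \<in> carrier (BijGroup \<H>)"
proof -
  have *: "mob (adj2 g) (mob g z) = z" "mob g (mob (adj2 g) z) = z" if "0 < Im z" for z
    using mob_mult[of "adj2 g" g z] mob_mult[of g "adj2 g" z] assms that by (simp_all add: adj2_mult mob_one)
  have "bij_betw (restrict (mob g) \<H>) \<H> \<H>"
    by (rule bij_betw_byWitness[where f' = "mob (adj2 g)"]) (use assms * mob_hvec(1) in auto)
  then show ?thesis by (simp add: BijGroup_def Bij_def moebius_transf_mob)
qed

lemma moebius_transf_mult:
  assumes "det g = 1" "det h = 1"
  shows "moebius_transf (g ** h) = moebius_transf g \<otimes>\<^bsub>BijGroup \<H>\<^esub> moebius_transf h"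
proof (rule BijGroup_eqI)
  have "det (g ** h) = 1" using assms by (simp add: det_mul)
  then show "moebius_transf (g ** h) \<in> carrier (BijGroup \<H>)" by (rule moebius_transf_in_BijGroup)
  show "moebius_transf g \<otimes>\<^bsub>BijGroup \<H>\<^esub> moebius_transf h \<in> carrier (BijGroup \<H>)"
    using assms group_BijGroup by (auto intro!: monoid.m_closed group.is_monoid moebius_transf_in_BijGroup)
  fix z assume "z \<in> \<H>"
  then have "(moebius_transf g \<otimes>\<^bsub>BijGroup \<H>\<^esub> moebius_transf h) z = moebius_transf g (moebius_transf h z)"
    using assms by (intro BijGroup_mult moebius_transf_in_BijGroup)
  then show "moebius_transf (g ** h) z = (moebius_transf g \<otimes>\<^bsub>BijGroup \<H>\<^esub> moebius_transf h) z"
    using assms \<open>z \<in> \<H>\<close> mob_hvec(1)[of h z] mob_mult[of g h z] by (simp add: moebius_transf_mob)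
qed

lemma moebius_transf_one: "moebius_transf (mat 1) = \<one>\<^bsub>BijGroup \<H>\<^esub>"
  by (simp add: moebius_transf_mob BijGroup_def mob_one fun_eq_iff restrict_def)

section \<open>Reflections\<close>

text \<open>The antiholomorphic Moebius transformation with matrix \<open>((- \<beta>, - 2 \<gamma>), (2 \<alpha>, \<beta>))\<close> for \<open>w = (\<alpha>,
  \<beta>, \<gamma>)\<close>. For \<open>w = (0, 1, 0)\<close> it is \<open>z \<mapsto> - cnj z\<close>.\<close>

definition mirror_map :: "real^3 \<Rightarrow> complex \<Rightarrow> complex" where
  "mirror_map w z = - (of_real (w$2) * cnj z + 2 * of_real (w$3)) / (2 * of_real (w$1) * cnj z + of_real (w$2))"

lemma mirror_map_denominator:
  assumes "lorentz w w = 1" "0 < Im z"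
  shows "2 * of_real (w$1) * cnj z + of_real (w$2) \<noteq> 0"
proof
  assume *: "2 * of_real (w$1) * cnj z + of_real (w$2) = 0"
  then have "Im (2 * of_real (w$1) * cnj z + of_real (w$2)) = 0" "Re (2 * of_real (w$1) * cnj z + of_real (w$2)) = 0"
    by simp_all
  then have "w$1 = 0" "w$2 = 0" using assms by auto
  then show False using assms by (simp add: lorentz_def)
qed

text \<open>In the hyperboloid model the map is the linear reflection along the vector that is dual to \<open>w\<close>
  with respect to the Lorentz form.\<close>

lemma
  assumes "lorentz w w = 1" "0 < Im z"
  shows Im_mirror_map_pos: "0 < Im (mirror_map w z)"
    and hvec_mirror_map: "hvec (mirror_map w z) = hvec z - (2 * level w z) *\<^sub>R vector [- 2 * w$3, w$2, - 2 * w$1]"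
proof -
  let ?n = "of_real (w$2) * cnj z + 2 * of_real (w$3)" and ?d = "2 * of_real (w$1) * cnj z + of_real (w$2)"
  define D where "D = (2 * w$1 * Re z + w$2)\<^sup>2 + (2 * w$1 * Im z)\<^sup>2"
  have Dd: "D = (cmod ?d)\<^sup>2" by (simp add: D_def cmod_power2)
  have D: "0 < D" using mirror_map_denominator[OF assms] by (simp add: Dd)
  have L: "w$2 * w$2 = 1 + 4 * w$1 * w$3" using assms by (simp add: lorentz_def)
  have "Im (mirror_map w z) = lorentz w w * Im z / D"
    by (simp add: mirror_map_def Im_divide D_def lorentz_def) (simp add: algebra_simps power2_eq_square)
  then have Im: "Im (mirror_map w z) = Im z / D" using assms by simp
  have Re: "Re (mirror_map w z) = - (2 * w$1 * w$2 * ((Re z)\<^sup>2 + (Im z)\<^sup>2) + (w$2 * w$2 + 4 * w$1 * w$3) * Re z + 2 * w$2 * w$3) / D"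
    by (simp add: mirror_map_def Re_divide D_def) (simp add: algebra_simps power2_eq_square)
  have sq: "(Re (mirror_map w z))\<^sup>2 + (Im (mirror_map w z))\<^sup>2 = ((w$2 * Re z + 2 * w$3)\<^sup>2 + (w$2 * Im z)\<^sup>2) / D"
    unfolding cmod_power2[symmetric] mirror_map_def norm_divide power_divide Dd[symmetric] norm_minus_cancel
    by (simp add: cmod_power2)
  show "0 < Im (mirror_map w z)" using D assms Im by simp
  have z: "Im z \<noteq> 0" using assms by simp
  have 1: "hvec (mirror_map w z) $ 1 = hvec z $ 1 - 2 * level w z * (- 2 * w$3)"
  proof -
    have "(w$2 * Re z + 2 * w$3)\<^sup>2 + (w$2 * Im z)\<^sup>2 = 
        (w$2 * w$2) * ((Re z)\<^sup>2 + (Im z)\<^sup>2) + 4 * w$2 * w$3 * Re z + 4 * w$3 * w$3"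
      by (simp add: power2_eq_square algebra_simps)
    also have "\<dots> = ((Re z)\<^sup>2 + (Im z)\<^sup>2) + 4 * w$3 * geodesic_poly w z"
      unfolding L by (simp add: geodesic_poly_def algebra_simps)
    finally have "(w$2 * Re z + 2 * w$3)\<^sup>2 + (w$2 * Im z)\<^sup>2 = ((Re z)\<^sup>2 + (Im z)\<^sup>2) + 4 * w$3 * geodesic_poly w z" .
    then have "hvec (mirror_map w z) $ 1 = ((Re z)\<^sup>2 + (Im z)\<^sup>2 + 4 * w$3 * geodesic_poly w z) / Im z"
      unfolding hvec_nth sq using D by (simp add: Im)
    then show ?thesis by (simp add: level_geodesic_poly add_divide_distrib)
  qed
  have 2: "hvec (mirror_map w z) $ 2 = hvec z $ 2 - 2 * level w z * w$2"
  proof -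
    have "- (2 * w$1 * w$2 * ((Re z)\<^sup>2 + (Im z)\<^sup>2) + (w$2 * w$2 + 4 * w$1 * w$3) * Re z + 2 * w$2 * w$3)
       = Re z - 2 * w$2 * geodesic_poly w z + (w$2 * w$2 - (1 + 4 * w$1 * w$3)) * Re z"
      by (simp add: geodesic_poly_def algebra_simps)
    then have "- (2 * w$1 * w$2 * ((Re z)\<^sup>2 + (Im z)\<^sup>2) + (w$2 * w$2 + 4 * w$1 * w$3) * Re z + 2 * w$2 * w$3)
       = Re z - 2 * w$2 * geodesic_poly w z" using L by simp
    then have "Re (mirror_map w z) = (Re z - 2 * w$2 * geodesic_poly w z) / D" unfolding Re by simp
    then have "hvec (mirror_map w z) $ 2 = (Re z - 2 * w$2 * geodesic_poly w z) / Im z"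
      unfolding hvec_nth Im using D by simp
    then show ?thesis by (simp add: level_geodesic_poly diff_divide_distrib)
  qed
  have 3: "hvec (mirror_map w z) $ 3 = hvec z $ 3 - 2 * level w z * (- 2 * w$1)"
  proof -
    have "D = 1 + 4 * w$1 * geodesic_poly w z + (w$2 * w$2 - (1 + 4 * w$1 * w$3))"
      by (simp add: D_def geodesic_poly_def power2_eq_square algebra_simps)
    then have "D = 1 + 4 * w$1 * geodesic_poly w z" using L by simp
    then show ?thesis by (simp add: level_geodesic_poly Im add_divide_distrib)
  qed
  show "hvec (mirror_map w z) = hvec z - (2 * level w z) *\<^sub>R vector [- 2 * w$3, w$2, - 2 * w$1]"
    unfolding vec_eq_iff forall_3 using 1 2 3 by (simp del: hvec_nth)
qed

lemma level_mirror_map: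
  assumes "lorentz w w = 1" "0 < Im z"
  shows "level v (mirror_map w z) = level v z - 2 * lorentz w v * level w z"
  unfolding hvec_mirror_map[OF assms]
  by (simp add: inner_diff_right) (simp add: inner_vec_def sum_3 lorentz_def algebra_simps)

lemma mirror_map_involution:
  assumes "lorentz w w = 1" "0 < Im z"
  shows "mirror_map w (mirror_map w z) = z"
proof -
  have 1: "0 < Im (mirror_map w z)" using Im_mirror_map_pos[OF assms] .
  have "hvec (mirror_map w (mirror_map w z)) = hvec z"
    unfolding hvec_mirror_map[OF assms(1) 1] level_mirror_map[OF assms] using assms(1) hvec_mirror_map[OF assms] by simp
  then show ?thesis using hvec_inject Im_mirror_map_pos[OF assms(1) 1] assms(2) by blast
qed

lemma mirror_map_in_BijGroup: "lorentz w w = 1 \<Longrightarrow> restrict (mirror_map w) \<H> \<in> carrier (BijGroup \<H>)"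
  by (rule involution_in_BijGroup) (auto simp: Im_mirror_map_pos mirror_map_involution)

lemma mirror_map_uminus: "mirror_map (- w) = mirror_map w"
proof
  fix z
  have "mirror_map (- w) z = - (- (of_real (w$2) * cnj z + 2 * of_real (w$3))) / (- (2 * of_real (w$1) * cnj z + of_real (w$2)))"
    unfolding mirror_map_def by (simp add: algebra_simps)
  then show "mirror_map (- w) z = mirror_map w z" unfolding mirror_map_def by (simp only: minus_divide_divide)
qed

text \<open>The matrices of two antiholomorphic maps multiply to the matrix of a Moebius transformation,
  because their entries are real. Each has determinant \<open>-1\<close>.\<close>

lemma mirror_map_mirror_map_mob:
  assumes "lorentz u u = 1" "lorentz v v = 1"
  obtains g where "det g = 1" "\<And>z. 0 < Im z \<Longrightarrow> mob g z = mirror_map u (mirror_map v z)"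
proof
  let ?A = "\<lambda>w :: real^3. vector [vector [- w$2, - 2 * w$3], vector [2 * w$1, w$2]] :: real^2^2"
  have "det (?A w) = - lorentz w w" for w by (simp add: det_2 lorentz_def)
  then show "det (?A u ** ?A v) = 1" using assms by (simp add: det_mul)
  fix z assume z: "0 < Im z"
  let ?d = "2 * of_real (v$1) * z + of_real (v$2)"
  have "cnj ?d = 2 * of_real (v$1) * cnj z + of_real (v$2)" by simp
  then have d: "?d \<noteq> 0" using mirror_map_denominator[OF assms(2) z] by (metis complex_cnj_zero)
  have c: "cnj (mirror_map v z) = - (of_real (v$2) * z + 2 * of_real (v$3)) / ?d"
    by (simp add: mirror_map_def)
  have "mirror_map u (mirror_map v z) = - (of_real (u$2) * - (of_real (v$2) * z + 2 * of_real (v$3)) + 2 * of_real (u$3) * ?d)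
      / (2 * of_real (u$1) * - (of_real (v$2) * z + 2 * of_real (v$3)) + of_real (u$2) * ?d)"
    unfolding mirror_map_def[of u] c using d by (simp add: divide_simps)
  also have "\<dots> = mob (?A u ** ?A v) z"
    unfolding mob_def matrix_matrix_mult_def by (simp add: sum_2 algebra_simps)
  finally show "mob (?A u ** ?A v) z = mirror_map u (mirror_map v z)" by simp
qed

text \<open>The functional that \<open>T\<^sub>g\<close> pulls back from \<open>Re z / Im z\<close>, the functional of the imaginary
  axis.\<close>

definition axis_functional :: "real^2^2 \<Rightarrow> real^3" where
  "axis_functional g = vector [g$1$1 * g$2$1, g$1$1 * g$2$2 + g$1$2 * g$2$1, g$1$2 * g$2$2]"

text \<open>For \<open>\<alpha> \<noteq> 0\<close> the equations \<open>a c = \<alpha>\<close>, \<open>a d + b c = \<beta>\<close>, \<open>a d - b c = 1\<close> are solved with \<open>a =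
  1\<close>.\<close>

lemma axis_functional_exists:
  assumes "lorentz w w = 1"
  obtains g where "det g = 1" "axis_functional g = w \<or> axis_functional g = - w"
proof (cases "w$1 = 0")
  case True
  then have w2: "w$2 = 1 \<or> w$2 = -1" using assms by (simp add: lorentz_def square_eq_1_iff)
  let ?g = "vector [vector [1, w$2 * w$3], vector [0, 1]] :: real^2^2"
  have "axis_functional ?g = w \<or> axis_functional ?g = - w"
    using w2 True by (auto simp: axis_functional_def vec_eq_iff forall_3)
  then show ?thesis using that[of ?g] by (simp add: det_2)
next
  case False
  let ?g = "vector [vector [1, (w$2 - 1) / (2 * w$1)], vector [w$1, (w$2 + 1) / 2]] :: real^2^2"
  have "det ?g = 1" using False by (simp add: det_2 field_simps)
  moreover have "(w$2 - 1) * (w$2 + 1) = 4 * w$1 * w$3"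
    using assms by (simp add: lorentz_def algebra_simps)
  then have "axis_functional ?g = w"
    using False by (simp add: axis_functional_def vec_eq_iff forall_3 field_simps)
  ultimately show ?thesis using that by blast
qed

lemma mob_image_imaginary_axis:
  assumes "det g = 1" 
  shows "moebius_transf g ` l = imaginary_axis \<and> l \<subseteq> \<H> \<longleftrightarrow> l = mirror (axis_functional g)"
proof -
  have bij: "bij_betw (moebius_transf g) \<H> \<H>"
    using moebius_transf_in_BijGroup[OF assms] by (simp add: BijGroup_def Bij_def)
  have m: "z \<in> mirror (axis_functional g) \<longleftrightarrow> moebius_transf g z \<in> imaginary_axis" if "z \<in> \<H>" for z
  proof -
    have "0 < Im (mob g z)" "level (axis_functional g) z = Re (mob g z) / Im (mob g z)"
      using mob_hvec[OF assms, of z] that by (simp_all add: axis_functional_def level_geodesic_poly)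
    then show ?thesis
      using that by (simp add: mirror_def imaginary_axis_def moebius_transf_mob zero_less_mult_iff)
  qed
  have sub: "mirror (axis_functional g) \<subseteq> \<H>" "imaginary_axis \<subseteq> \<H>" by (auto simp: mirror_def imaginary_axis_def)
  have inj: "inj_on (moebius_transf g) \<H>" and surj: "moebius_transf g ` \<H> = \<H>"
    using bij by (auto simp: bij_betw_def)
  have im: "moebius_transf g ` mirror (axis_functional g) = imaginary_axis"
  proof
    show "moebius_transf g ` mirror (axis_functional g) \<subseteq> imaginary_axis" using m sub by blast
    show "imaginary_axis \<subseteq> moebius_transf g ` mirror (axis_functional g)"
    proof
      fix y assume y: "y \<in> imaginary_axis"
      then obtain x where "x \<in> \<H>" "y = moebius_transf g x" using sub surj by blast
      then show "y \<in> moebius_transf g ` mirror (axis_functional g)" using m y by blast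
    qed
  qed
  then show ?thesis using sub inj inj_on_image_eq_iff[OF inj, of l "mirror (axis_functional g)"] by auto
qed

lemma mob_mirror_map_axis_functional:
  assumes "det g = 1" "0 < Im z"
  shows "mob g (mirror_map (axis_functional g) z) = - cnj (mob g z)"
proof -
  define a b c d where "a = complex_of_real (g$1$1)" "b = complex_of_real (g$1$2)" "c = complex_of_real (g$2$1)" "d = complex_of_real (g$2$2)"
  have dt: "a * d - b * c = 1"
    using assms by (simp add: a_b_c_d_def det_2 flip: of_real_mult of_real_diff)
  let ?n = "(a * d + b * c) * cnj z + 2 * (b * d)" and ?e = "2 * (a * c) * cnj z + (a * d + b * c)"
  have L: "lorentz (axis_functional g) (axis_functional g) = (det g)\<^sup>2"
    by (simp add: lorentz_def axis_functional_def det_2 power2_eq_square algebra_simps)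
  have e: "?e \<noteq> 0"
    using mirror_map_denominator[of "axis_functional g" z] assms L by (simp add: axis_functional_def a_b_c_d_def)
  have r: "mirror_map (axis_functional g) z = - ?n / ?e"
    by (simp add: mirror_map_def axis_functional_def a_b_c_d_def)
  have "mob g (- ?n / ?e) = (a * - ?n + b * ?e) / (c * - ?n + d * ?e)"
    using e by (simp add: mob_def a_b_c_d_def[symmetric] divide_simps)
  also have "a * - ?n + b * ?e = - ((a * d - b * c) * (a * cnj z + b))" by (simp add: algebra_simps)
  also have "c * - ?n + d * ?e = (a * d - b * c) * (c * cnj z + d)" by (simp add: algebra_simps)
  also have "- ((a * d - b * c) * (a * cnj z + b)) / ((a * d - b * c) * (c * cnj z + d)) = - cnj (mob g z)"
  proof -
    have "cnj (mob g z) = (a * cnj z + b) / (c * cnj z + d)" by (simp add: mob_def a_b_c_d_def)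
    then show ?thesis by (simp only: dt mult_1 minus_divide_left)
  qed
  finally show ?thesis unfolding r .
qed

text \<open>The element chosen in the definition of the reflection is unknown, but its axis functional
  vanishes on the same geodesic as \<open>w\<close>, so it is \<open>w\<close> or \<open>- w\<close>, and both define the same map.\<close>

lemma reflection_mirror:
  assumes w: "lorentz w w = 1" and pq: "p \<in> mirror w" "q \<in> mirror w" "p \<noteq> q"
  shows "reflection (mirror w) = restrict (mirror_map w) \<H>"
proof -
  let ?P = "\<lambda>g. g \<in> carrier SL2R \<and> moebius_transf g ` mirror w = imaginary_axis"
  define g where "g = (SOME g. ?P g)"
  have sub: "mirror w \<subseteq> \<H>" by (auto simp: mirror_def)
  have um: "mirror (- w) = mirror w" by (simp add: mirror_def)
  obtain h where h: "det h = 1" "axis_functional h = w \<or> axis_functional h = - w"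
    using axis_functional_exists[OF w] .
  have "?P h" using h um mob_image_imaginary_axis[OF h(1), of "mirror w"] by (auto simp: carrier_SL2R)
  then have "?P g" unfolding g_def by (rule someI)
  then have g: "det g = 1" "mirror w = mirror (axis_functional g)"
    using mob_image_imaginary_axis[of g "mirror w"] sub by (auto simp: carrier_SL2R)
  have L: "lorentz (axis_functional g) (axis_functional g) = (det g)\<^sup>2"
    by (simp add: lorentz_def axis_functional_def det_2 power2_eq_square algebra_simps)
  have "axis_functional g = w \<or> axis_functional g = - w"
    using functional_unique[of p q w "axis_functional g"] pq w L g by simp
  then have rw: "mirror_map (axis_functional g) = mirror_map w" using mirror_map_uminus by metis
  let ?B = "BijGroup \<H>"
  interpret B: group ?B by (rule group_BijGroup)
  let ?R = "restrict (mirror_map w) \<H>" and ?T = "moebius_transf g"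
  have R: "?R \<in> carrier ?B" using mirror_map_in_BijGroup[OF w] .
  have T: "?T \<in> carrier ?B" using moebius_transf_in_BijGroup[OF g(1)] .
  have R0: "reflection_imaginary_axis \<in> carrier ?B"
    unfolding reflection_imaginary_axis_def by (rule involution_in_BijGroup) auto
  have "reflection_imaginary_axis \<otimes>\<^bsub>?B\<^esub> ?T = ?T \<otimes>\<^bsub>?B\<^esub> ?R"
  proof (rule BijGroup_eqI)
    fix z assume z: "z \<in> \<H>"
    then have "mob g (mirror_map w z) = - cnj (mob g z)"
      using mob_mirror_map_axis_functional[OF g(1), of z] rw by simp
    then show "(reflection_imaginary_axis \<otimes>\<^bsub>?B\<^esub> ?T) z = (?T \<otimes>\<^bsub>?B\<^esub> ?R) z"
      using z R T R0 Im_mirror_map_pos[OF w, of z] mob_hvec(1)[OF g(1), of z]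
      by (simp add: BijGroup_mult reflection_imaginary_axis_def moebius_transf_mob)
  qed (use R T R0 in auto)
  then have "inv\<^bsub>?B\<^esub> ?T \<otimes>\<^bsub>?B\<^esub> reflection_imaginary_axis \<otimes>\<^bsub>?B\<^esub> ?T = inv\<^bsub>?B\<^esub> ?T \<otimes>\<^bsub>?B\<^esub> (?T \<otimes>\<^bsub>?B\<^esub> ?R)"
    using R T R0 by (simp add: B.m_assoc)
  also have "\<dots> = ?R" using R T by (simp flip: B.m_assoc)
  finally show ?thesis by (simp add: reflection_def g_def Let_def)
qed

section \<open>Angles between geodesics\<close>

text \<open>The Euclidean gradient of the equation of a geodesic. It is a unit normal at the points of the
  geodesic if the functional is normalised, so angles between geodesics can be computed from it.\<close>

definition geodesic_gradient :: "real^3 \<Rightarrow> complex \<Rightarrow> complex" where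
  "geodesic_gradient w z = Complex (2 * w$1 * Re z + w$2) (2 * w$1 * Im z)"

lemma gradient_inner:
  assumes "geodesic_poly w z = 0" "geodesic_poly w' z = 0"
  shows "geodesic_gradient w z \<bullet> geodesic_gradient w' z = lorentz w w'"
proof -
  have "geodesic_gradient w z \<bullet> geodesic_gradient w' z = lorentz w w' + 2 * w$1 * geodesic_poly w' z + 2 * w'$1 * geodesic_poly w z"
    by (simp add: geodesic_gradient_def inner_complex_def lorentz_def geodesic_poly_def power2_eq_square algebra_simps)
  then show ?thesis using assms by simp
qed

lemma geodesic_poly_has_derivative:
  assumes "(c has_vector_derivative D) (at t)"
  shows "((\<lambda>t. geodesic_poly w (c t)) has_real_derivative geodesic_gradient w (c t) \<bullet> D) (at t)"
proof -
  have re: "((\<lambda>t. Re (c t)) has_real_derivative Re D) (at t)"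
    unfolding has_real_derivative_iff_has_vector_derivative
    by (rule bounded_linear.has_vector_derivative[OF bounded_linear_Re assms])
  have im: "((\<lambda>t. Im (c t)) has_real_derivative Im D) (at t)"
    unfolding has_real_derivative_iff_has_vector_derivative
    by (rule bounded_linear.has_vector_derivative[OF bounded_linear_Im assms])
  show ?thesis
    unfolding geodesic_poly_def
    by (rule derivative_eq_intros re im refl | simp add: geodesic_gradient_def inner_complex_def algebra_simps power2_eq_square)+
qed

lemma right_derivative_nonneg:
  fixes f :: "real \<Rightarrow> real"
  assumes "(f has_real_derivative L) (at 0)" "\<And>t. 0 < t \<Longrightarrow> t \<le> 1 \<Longrightarrow> f 0 \<le> f t"
  shows "0 \<le> L"
proof (rule ccontr)
  assume "\<not> 0 \<le> L"
  then obtain d where d: "0 < d" "\<And>h. 0 < h \<Longrightarrow> h < d \<Longrightarrow> f (0 + h) < f 0"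
    using DERIV_neg_dec_right[OF assms(1)] by auto
  define h where "h = min (d / 2) 1"
  have h: "0 < h" "h < d" "h \<le> 1" using d(1) by (auto simp: h_def)
  show False using d(2)[OF h(1,2)] assms(2)[OF h(1,3)] by simp
qed

text \<open>The tangent of an arc along \<open>w\<close> is orthogonal to the gradient of \<open>w\<close>. Its direction is
  determined by a second geodesic \<open>w'\<close> through the starting point: the arc meets \<open>w'\<close> only there,
  so by the intermediate value theorem the equation of \<open>w'\<close> keeps the sign that it has at the end
  point.\<close>

lemma geodesic_arc_direction:
  assumes "geodesic_arc c p q" and H: "0 < Im p" "0 < Im q" and "p \<noteq> q"
    and w: "lorentz w w = 1" "geodesic_poly w p = 0" "geodesic_poly w q = 0"
    and w': "lorentz w' w' = 1" "geodesic_poly w' p = 0" "0 < geodesic_poly w' q"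
  defines "D \<equiv> vector_derivative c (at 0)"
  shows "D \<noteq> 0" "geodesic_gradient w p \<bullet> D = 0" "0 \<le> geodesic_gradient w' p \<bullet> D"
proof -
  note arc = assms(1)[unfolded geodesic_arc_def]
  have c: "arc c" "c 0 = p" "c 1 = q" using arc by (auto simp: pathstart_def pathfinish_def)
  show "D \<noteq> 0" using arc by (auto simp: D_def)
  have D: "(c has_vector_derivative D) (at 0)"
    using arc unfolding C1_differentiable_on_eq D_def by (auto simp: vector_derivative_works)
  obtain u where u: "lorentz u u = 1" "path_image c \<subseteq> mirror u"
  proof -
    obtain l where l: "l \<in> geodesics" "path_image c \<subseteq> l" using arc by blast
    then show ?thesis using that geodesic_iff_mirror[of l] by blast
  qed
  have pq: "p \<in> path_image c" "q \<in> path_image c" using c by (auto simp: path_image_def)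
  have pqw: "p \<in> mirror w" "q \<in> mirror w" using H w by (simp_all add: mirror_def level_eq_0_iff)
  have "u = w \<or> u = - w"
    using functional_unique[OF \<open>p \<noteq> q\<close> pqw, of u] pq u w by auto
  then have "mirror u = mirror w" by (auto simp: mirror_def)
  then have on: "c t \<in> mirror w" if "t \<in> {0..1}" for t
    using u that by (auto simp: path_image_def)
  then have Hc: "0 < Im (c t)" and zero: "geodesic_poly w (c t) = 0" if "t \<in> {0..1}" for t
    using on[OF that] level_eq_0_iff[of "c t" w] by (auto simp: mirror_def)
  \<comment> \<open>The equation of \<open>w\<close> vanishes along the arc, so neither it nor its negative has a negative
    derivative.\<close>
  have "0 \<le> geodesic_gradient w (c 0) \<bullet> D"
    using geodesic_poly_has_derivative[OF D, of w] zero by (intro right_derivative_nonneg) auto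
  moreover have "0 \<le> - (geodesic_gradient w (c 0) \<bullet> D)"
    using DERIV_minus[OF geodesic_poly_has_derivative[OF D, of w]] zero by (intro right_derivative_nonneg) auto
  ultimately show "geodesic_gradient w p \<bullet> D = 0" using c by simp
  have cont: "continuous_on {0..1} (\<lambda>t. geodesic_poly w' (c t))"
    using \<open>arc c\<close> unfolding geodesic_poly_def arc_def path_def by (intro continuous_intros) auto
  have nz: "geodesic_poly w' (c t) \<noteq> 0" if "0 < t" "t \<le> 1" for t
  proof
    assume "geodesic_poly w' (c t) = 0"
    then have "p \<in> mirror w'" "c t \<in> mirror w'" using w' H Hc[of t] that by (simp_all add: mirror_def level_eq_0_iff)
    moreover have "c t \<noteq> p"
      using \<open>arc c\<close> c that inj_onD[of c "{0..1}" t 0] by (auto simp: arc_def)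
    ultimately have "w' = w \<or> w' = - w"
      using functional_unique[of p "c t" w w'] on[of t] pqw w w' that by auto
    then show False using w w' by (auto simp: geodesic_poly_def)
  qed
  have pos: "0 < geodesic_poly w' (c t)" if t: "0 < t" "t \<le> 1" for t
  proof (rule ccontr)
    assume "\<not> 0 < geodesic_poly w' (c t)"
    then have "geodesic_poly w' (c t) \<le> 0" by simp
    moreover have "continuous_on {t..1} (\<lambda>t. geodesic_poly w' (c t))"
      using t by (intro continuous_on_subset[OF cont]) auto
    ultimately obtain x where "t \<le> x" "x \<le> 1" "geodesic_poly w' (c x) = 0"
      using IVT'[of "\<lambda>t. geodesic_poly w' (c t)" t 0 1] w' c t by auto
    then show False using nz[of x] t by simp
  qed
  show "0 \<le> geodesic_gradient w' p \<bullet> D"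
    using right_derivative_nonneg[OF geodesic_poly_has_derivative[OF D, of w']] pos c w'
    by (metis less_imp_le)
qed

text \<open>With unit normals \<open>N\<close> and \<open>N'\<close> the two tangents are multiples \<open>k\<close> and \<open>l\<close> of the rotated
  normals \<open>J N\<close> and \<open>J N'\<close>. As each arc runs to the positive side of the other geodesic and \<open>N' \<bullet>
  J N = - (N \<bullet> J N')\<close>, the numbers \<open>k\<close> and \<open>l\<close> have opposite signs. Hence the cosine of the angle
  is \<open>- (N \<bullet> N') = - lorentz w w'\<close>.\<close>

lemma angle_between_geodesic_arcs:
  assumes c: "geodesic_arc c p q" and d: "geodesic_arc d p r"
    and H: "0 < Im p" "0 < Im q" "0 < Im r" and ne: "p \<noteq> q" "p \<noteq> r"
    and w: "lorentz w w = 1" "geodesic_poly w p = 0" "geodesic_poly w q = 0" "0 < geodesic_poly w r"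
    and w': "lorentz w' w' = 1" "geodesic_poly w' p = 0" "geodesic_poly w' r = 0" "0 < geodesic_poly w' q"
  defines "u \<equiv> vector_derivative c (at 0)" and "v \<equiv> vector_derivative d (at 0)"
  shows "(u \<bullet> v) / (norm u * norm v) = - lorentz w w'"
proof -
  define N where "N = geodesic_gradient w p"
  define N' where "N' = geodesic_gradient w' p"
  have NN: "N \<bullet> N = 1" "N' \<bullet> N' = 1" "N \<bullet> N' = lorentz w w'"
    using w w' by (simp_all add: N_def N'_def gradient_inner)
  have u: "u \<noteq> 0" "N \<bullet> u = 0" "0 \<le> N' \<bullet> u"
    using geodesic_arc_direction[OF c H(1,2) ne(1) w(1,2,3) w'(1,2,4)] by (simp_all add: u_def N_def N'_def)
  have v: "v \<noteq> 0" "N' \<bullet> v = 0" "0 \<le> N \<bullet> v"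
    using geodesic_arc_direction[OF d H(1,3) ne(2) w'(1,2,3) w(1,2,4)] by (simp_all add: v_def N_def N'_def)
  define J where "J z = Complex (- Im z) (Re z)" for z
  define k where "k = J N \<bullet> u"
  define l where "l = J N' \<bullet> v"
  define s where "s = N' \<bullet> J N"
  have n1: "(Re N)\<^sup>2 + (Im N)\<^sup>2 = 1" "(Re N')\<^sup>2 + (Im N')\<^sup>2 = 1"
    using NN by (simp_all add: inner_complex_def power2_eq_square)
  have uk: "u = k *\<^sub>R J N"
  proof -
    have "Re u = Re u * ((Re N)\<^sup>2 + (Im N)\<^sup>2)" "Im u = Im u * ((Re N)\<^sup>2 + (Im N)\<^sup>2)" using n1 by simp_all
    moreover have "Re N * Re u = - Im N * Im u" using u(2) by (simp add: inner_complex_def)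
    ultimately show ?thesis
      by (simp add: k_def J_def complex_eq_iff inner_complex_def) algebra
  qed
  have vl: "v = l *\<^sub>R J N'"
  proof -
    have "Re v = Re v * ((Re N')\<^sup>2 + (Im N')\<^sup>2)" "Im v = Im v * ((Re N')\<^sup>2 + (Im N')\<^sup>2)" using n1 by simp_all
    moreover have "Re N' * Re v = - Im N' * Im v" using v(2) by (simp add: inner_complex_def)
    ultimately show ?thesis
      by (simp add: l_def J_def complex_eq_iff inner_complex_def) algebra
  qed
  have nJ: "norm (J N) = 1" "norm (J N') = 1"
    using n1 by (simp_all add: J_def cmod_def add.commute)
  have s': "N \<bullet> J N' = - s" by (simp add: s_def J_def inner_complex_def)
  have "0 \<le> k * s" using u(3) by (subst (asm) uk) (simp add: s_def)
  moreover have "l * s \<le> 0" using v(3) by (subst (asm) vl) (simp add: s')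
  \<comment> \<open>Otherwise the normals are parallel at \<open>p\<close>, so the two functionals are proportional, but
    only \<open>w\<close> vanishes at \<open>q\<close>.\<close>
  moreover have "s \<noteq> 0"
  proof
    assume "s = 0"
    then have "Im N' * Re N = Re N' * Im N" by (simp add: s_def J_def inner_complex_def)
    moreover define x where "x = N \<bullet> N'"
    ultimately have "N' = x *\<^sub>R N"
      using n1 unfolding x_def complex_eq_iff inner_complex_def by simp algebra
    then have "2 * w'$1 * Im p = 2 * (x * w$1) * Im p" "2 * w'$1 * Re p + w'$2 = x * (2 * w$1 * Re p + w$2)"
      by (simp_all add: N_def N'_def geodesic_gradient_def complex_eq_iff)
    then have 1: "w'$1 = x * w$1" using H by simp
    then have 2: "w'$2 = x * w$2" using \<open>2 * w'$1 * Re p + w'$2 = x * (2 * w$1 * Re p + w$2)\<close> by (simp add: algebra_simps)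
    have "w'$3 - x * w$3 = geodesic_poly w' p - x * geodesic_poly w p"
      unfolding geodesic_poly_def 1 2 by (simp add: algebra_simps)
    then have 3: "w'$3 = x * w$3" using w w' by simp
    have "geodesic_poly w' q = x * geodesic_poly w q" unfolding geodesic_poly_def 1 2 3 by (simp add: algebra_simps)
    then show False using w w' by simp
  qed
  moreover have "k \<noteq> 0" "l \<noteq> 0" using uk vl u v by auto
  moreover note kl0 = this
  ultimately have "k * l < 0"
    by (metis linorder_not_less mult_neg_pos mult_pos_neg mult_pos_pos mult_neg_neg not_less_iff_gr_or_eq order_less_le)
  then have kl: "\<bar>k\<bar> * \<bar>l\<bar> = - (k * l)" by (simp add: abs_mult[symmetric])
  have "J N \<bullet> J N' = lorentz w w'" unfolding NN(3)[symmetric] by (simp add: J_def inner_complex_def)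
  then have "u \<bullet> v = k * l * lorentz w w'" by (subst uk, subst vl) simp
  moreover have "norm u * norm v = - (k * l)"
    unfolding kl[symmetric] by (subst uk, subst vl) (simp add: nJ)
  ultimately show ?thesis using kl0 by simp
qed

lemma lorentz_bound:
  assumes "lorentz w w = 1" "geodesic_poly w p = 0" "lorentz w' w' = 1" "geodesic_poly w' p = 0"
  shows "\<bar>lorentz w w'\<bar> \<le> 1"
proof -
  have "(norm (geodesic_gradient w p))\<^sup>2 = 1" "(norm (geodesic_gradient w' p))\<^sup>2 = 1"
    using assms by (simp_all add: power2_norm_eq_inner gradient_inner)
  then have "norm (geodesic_gradient w p) = 1" "norm (geodesic_gradient w' p) = 1"
    by (simp_all add: power2_eq_1_iff) (use norm_ge_zero in \<open>smt (verit)\<close>)+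
  then show ?thesis
    using Cauchy_Schwarz_ineq2[of "geodesic_gradient w p" "geodesic_gradient w' p"] assms by (simp add: gradient_inner)
qed

text \<open>A straight segment on a vertical line, and a parametrisation by the central angle on a
  semicircle.\<close>

lemma geodesic_arc_exists:
  assumes "p \<noteq> q" "0 < Im p" "0 < Im q"
  shows "\<exists>c. geodesic_arc c p q"
proof -
  obtain w where "lorentz w w = 1" "p \<in> mirror w" "q \<in> mirror w"
    using functional_exists[OF assms] .
  then obtain l where l: "l \<in> geodesics" "p \<in> l" "q \<in> l" using geodesic_iff_mirror by blast
  then consider a where "l = {z \<in> \<H>. Re z = a}" | a r where "r > 0" "l = {z \<in> \<H>. cmod (z - of_real a) = r}"
    unfolding geodesics_def by auto
  then show ?thesis
  proof cases
    case 1
    have der: "(linepath p q has_vector_derivative (q - p)) (at t)" for t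
      by (rule has_vector_derivative_linepath_within)
    have "geodesic_arc (linepath p q) p q"
      unfolding geodesic_arc_def
    proof (intro conjI ballI)
      show "arc (linepath p q)" using assms by (simp add: arc_linepath)
      show "\<exists>l\<in>geodesics. path_image (linepath p q) \<subseteq> l"
      proof (intro bexI[of _ l] l)
        have "convex l"
        proof -
          have "l = {z. 0 < inner \<i> z} \<inter> {z. inner 1 z = a}"
            unfolding 1 by (auto simp: inner_complex_def)
          then show ?thesis by (simp only: convex_Int convex_halfspace_gt convex_hyperplane)
        qed
        then show "path_image (linepath p q) \<subseteq> l" using l by (simp add: closed_segment_subset)
      qed
      show "linepath p q C1_differentiable_on {0..1}"
        unfolding C1_differentiable_on_def using der by (intro exI[of _ "\<lambda>_. q - p"]) auto
      show "vector_derivative (linepath p q) (at t) \<noteq> 0" for t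
        using vector_derivative_at[OF der] assms by simp
    qed auto
    then show ?thesis by blast
  next
    case 2
    define \<phi> where "\<phi> z = arccos ((Re z - a) / r)" for z
    have \<phi>: "z = of_real a + of_real r * cis (\<phi> z)" "0 < \<phi> z" "\<phi> z < pi" if "z \<in> l" for z
    proof -
      have "z \<in> {z \<in> \<H>. cmod (z - of_real a) = r}" using that 2(2) by simp
      then have "Im z > 0" and "cmod (z - of_real a) = r" by simp_all
      then have "(cmod (z - of_real a))\<^sup>2 = r\<^sup>2" by simp
      then have sq: "(Re z - a)\<^sup>2 + (Im z)\<^sup>2 = r\<^sup>2" by (simp add: cmod_power2)
      then have "(Re z - a)\<^sup>2 < r\<^sup>2" using \<open>Im z > 0\<close> by (smt (verit) zero_less_power)
      then have "\<bar>Re z - a\<bar>\<^sup>2 < r\<^sup>2" by simp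
      then have "\<bar>Re z - a\<bar> < r" by (rule power2_less_imp_less) (use \<open>r > 0\<close> in simp)
      then have b: "-1 < (Re z - a) / r" "(Re z - a) / r < 1" using \<open>r > 0\<close> by (auto simp: field_simps)
      have cos: "cos (\<phi> z) = (Re z - a) / r" using b by (simp add: \<phi>_def cos_arccos)
      have "sin (\<phi> z) = sqrt (1 - ((Re z - a) / r)\<^sup>2)" using b by (simp add: \<phi>_def sin_arccos)
      also have "1 - ((Re z - a) / r)\<^sup>2 = (Im z / r)\<^sup>2"
        using sq \<open>r > 0\<close> by (simp add: field_simps)
      also have "sqrt ((Im z / r)\<^sup>2) = Im z / r" using \<open>r > 0\<close> \<open>Im z > 0\<close> by simp
      finally have sin: "sin (\<phi> z) = Im z / r" .
      show "z = of_real a + of_real r * cis (\<phi> z)"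
        using \<open>r > 0\<close> by (simp add: complex_eq_iff cos sin)
      show "0 < \<phi> z" "\<phi> z < pi" using b arccos_lt_bounded by (auto simp: \<phi>_def)
    qed
    define \<psi> where "\<psi> t = \<phi> p + t * (\<phi> q - \<phi> p)" for t
    define c where "c t = of_real a + of_real r * cis (\<psi> t)" for t
    have ne: "\<phi> p \<noteq> \<phi> q" using \<phi>(1)[OF l(2)] \<phi>(1)[OF l(3)] assms by auto
    have range: "0 < \<psi> t" "\<psi> t < pi" if "t \<in> {0..1}" for t
    proof -
      have "convex {0<..<pi}" by (rule convex_real_interval)
      then have "(1 - t) *\<^sub>R \<phi> p + t *\<^sub>R \<phi> q \<in> {0<..<pi}"
        using that \<phi>(2,3)[OF l(2)] \<phi>(2,3)[OF l(3)] by (intro convexD) auto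
      moreover have "\<psi> t = (1 - t) *\<^sub>R \<phi> p + t *\<^sub>R \<phi> q" by (simp add: \<psi>_def algebra_simps)
      ultimately show "0 < \<psi> t" "\<psi> t < pi" by simp_all
    qed
    have der: "(c has_vector_derivative of_real (r * (\<phi> q - \<phi> p)) * (\<i> * cis (\<psi> t))) (at t)" for t
    proof -
      have "(\<psi> has_real_derivative (\<phi> q - \<phi> p)) (at t)"
        unfolding \<psi>_def by (auto intro!: derivative_eq_intros)
      then have "((\<lambda>t. \<i> * of_real (\<psi> t)) has_vector_derivative \<i> * of_real (\<phi> q - \<phi> p)) (at t)"
        by (intro derivative_intros)
      then have "(exp \<circ> (\<lambda>t. \<i> * of_real (\<psi> t)) has_vector_derivative
          (\<i> * of_real (\<phi> q - \<phi> p)) * exp (\<i> * of_real (\<psi> t))) (at t)"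
        by (rule field_vector_diff_chain_at) (rule DERIV_exp)
      then have "((\<lambda>t. of_real a + of_real r * cis (\<psi> t)) has_vector_derivative
          0 + of_real r * ((\<i> * of_real (\<phi> q - \<phi> p)) * cis (\<psi> t))) (at t)"
        unfolding cis_conv_exp comp_def by (intro has_vector_derivative_add has_vector_derivative_const has_vector_derivative_mult_right)
      then show ?thesis unfolding c_def by (simp add: algebra_simps)
    qed
    have "geodesic_arc c p q"
      unfolding geodesic_arc_def
    proof (intro conjI ballI)
      have "continuous_on {0..1} c"
        using der by (meson continuous_at_imp_continuous_on has_vector_derivative_continuous)
      moreover have "inj_on c {0..1}"
      proof (rule inj_onI)
        fix x y assume xy: "x \<in> {0..1}" "y \<in> {0..1}" "c x = c y"
        then have "Re (c x) = Re (c y)" by simp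
        then have "cos (\<psi> x) = cos (\<psi> y)" using \<open>r > 0\<close> by (simp add: c_def)
        then have "\<psi> x = \<psi> y" using range[OF xy(1)] range[OF xy(2)] cos_inj_pi by auto
        then show "x = y" using ne by (simp add: \<psi>_def)
      qed
      ultimately show "arc c" by (simp add: arc_def path_def)
      show "pathstart c = p" "pathfinish c = q"
        using \<phi>(1)[OF l(2)] \<phi>(1)[OF l(3)] by (simp_all add: pathstart_def pathfinish_def c_def \<psi>_def)
      show "\<exists>l\<in>geodesics. path_image c \<subseteq> l"
      proof (intro bexI[of _ l] l subsetI)
        fix z assume "z \<in> path_image c"
        then obtain t where t: "t \<in> {0..1}" "z = c t" by (auto simp: path_image_def)
        then show "z \<in> l"
          using range[OF t(1)] \<open>r > 0\<close> sin_gt_zero[of "\<psi> t"] unfolding 2(2) by (simp add: c_def norm_mult)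
      qed
      show "c C1_differentiable_on {0..1}"
        unfolding C1_differentiable_on_def
      proof (intro exI conjI ballI)
        show "(c has_vector_derivative of_real (r * (\<phi> q - \<phi> p)) * (\<i> * cis (\<psi> t))) (at t)" for t by (rule der)
        show "continuous_on {0..1} (\<lambda>t. of_real (r * (\<phi> q - \<phi> p)) * (\<i> * cis (\<psi> t)))"
          unfolding \<psi>_def by (intro continuous_intros)
      qed
      show "vector_derivative c (at t) \<noteq> 0" for t
        using vector_derivative_at[OF der] ne \<open>r > 0\<close> by simp
    qed
    then show ?thesis by blast
  qed
qed

text \<open>All pairs of arcs give the same value and there is at least one pair, so the definite
  description in the definition of the angle denotes it.\<close>

theorem hyp_angle_lorentz:
  assumes H: "0 < Im p" "0 < Im q" "0 < Im r" and ne: "p \<noteq> q" "p \<noteq> r"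
    and w: "lorentz w w = 1" "geodesic_poly w p = 0" "geodesic_poly w q = 0" "0 < geodesic_poly w r"
    and w': "lorentz w' w' = 1" "geodesic_poly w' p = 0" "geodesic_poly w' r = 0" "0 < geodesic_poly w' q"
  shows "cos (hyp_angle q p r) = - lorentz w w'"
proof -
  have "hyp_angle q p r = arccos (- lorentz w w')"
    unfolding hyp_angle_def
  proof (rule the_equality)
    obtain c d where cd: "geodesic_arc c p q" "geodesic_arc d p r"
      using geodesic_arc_exists H ne by blast
    then show "\<exists>c d. geodesic_arc c p q \<and> geodesic_arc d p r \<and>
        (let u = vector_derivative c (at 0); v = vector_derivative d (at 0)
         in arccos (- lorentz w w') = arccos ((u \<bullet> v) / (norm u * norm v)))"
      using angle_between_geodesic_arcs[OF cd H ne w w'] by (intro exI[of _ c] exI[of _ d]) (simp add: Let_def)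
  next
    fix \<theta> assume "\<exists>c d. geodesic_arc c p q \<and> geodesic_arc d p r \<and>
        (let u = vector_derivative c (at 0); v = vector_derivative d (at 0)
         in \<theta> = arccos ((u \<bullet> v) / (norm u * norm v)))"
    then obtain c d where "geodesic_arc c p q" "geodesic_arc d p r"
      "\<theta> = arccos ((vector_derivative c (at 0) \<bullet> vector_derivative d (at 0)) /
          (norm (vector_derivative c (at 0)) * norm (vector_derivative d (at 0))))"
      by (auto simp: Let_def)
    then show "\<theta> = arccos (- lorentz w w')"
      using angle_between_geodesic_arcs[OF _ _ H ne w w'] by simp
  qed
  then show ?thesis using lorentz_bound[OF w(1,2) w'(1,2)] by (simp add: cos_arccos_abs)
qed

section \<open>Distances in the hyperboloid model\<close>

text \<open>The polarisation of \<open>2 (A C - b\<^sup>2)\<close> on the hyperboloid side. On \<open>hvec p\<close> and \<open>hvec q\<close> it is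
  twice the hyperbolic cosine of the distance of \<open>p\<close> and \<open>q\<close>.\<close>

definition polar :: "real^3 \<Rightarrow> real^3 \<Rightarrow> real" where
  "polar u v = u$1 * v$3 + u$3 * v$1 - 2 * (u$2 * v$2)"

lemma polar_hvec:
  assumes "0 < Im p" "0 < Im q"
  shows "polar (hvec p) (hvec q) = ((Re p - Re q)\<^sup>2 + (Im p)\<^sup>2 + (Im q)\<^sup>2) / (Im p * Im q)"
  using assms by (simp add: polar_def field_simps power2_eq_square)

lemma polar_hvec_ge_2:
  assumes "0 < Im p" "0 < Im q"
  shows "2 \<le> polar (hvec p) (hvec q)"
proof -
  have "0 \<le> (Re p - Re q)\<^sup>2 + (Im p - Im q)\<^sup>2" by simp
  then have "2 * (Im p * Im q) \<le> (Re p - Re q)\<^sup>2 + (Im p)\<^sup>2 + (Im q)\<^sup>2"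
    by (simp add: power2_diff)
  then show ?thesis unfolding polar_hvec[OF assms] using assms by (simp add: pos_le_divide_eq)
qed

lemma polar_add: "polar (u + v) w = polar u w + polar v w" "polar w (u + v) = polar w u + polar w v"
  and polar_scale: "polar (k *\<^sub>R u) w = k * polar u w" "polar w (k *\<^sub>R u) = k * polar w u"
  and polar_minus: "polar (u - v) w = polar u w - polar v w"
  and polar_self: "polar v v = 2 * (v$1 * v$3 - (v$2)\<^sup>2)"
  by (simp_all add: polar_def algebra_simps power2_eq_square)

text \<open>Every vector inside the forward light cone can be scaled to the hyperboloid.\<close>

lemma hvec_surj:
  assumes "0 < v$3" "0 < polar v v"
  obtains z k where "0 < Im z" "0 < k" "hvec z = k *\<^sub>R v"
proof -
  define d where "d = v$1 * v$3 - (v$2)\<^sup>2"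
  have d: "0 < d" using assms(2) by (simp add: polar_self d_def)
  define z where "z = Complex (v$2 / v$3) (sqrt d / v$3)"
  have "((v$2)\<^sup>2 + d) = v$1 * v$3" by (simp add: d_def)
  then have "((v$2 / v$3)\<^sup>2 + (sqrt d / v$3)\<^sup>2) / (sqrt d / v$3) = v$1 / sqrt d"
    using d assms(1) by (simp add: power_divide power2_eq_square flip: add_divide_distrib)
  then have "hvec z = (1 / sqrt d) *\<^sub>R v"
    using d assms(1) by (simp add: vec_eq_iff forall_3 z_def)
  then show ?thesis using that[of z "1 / sqrt d"] d assms(1) by (simp add: z_def)
qed

text \<open>The trace of the symmetric matrix that \<open>hvec z\<close> represents. It equals \<open>2 cosh\<close> of the distance
  from \<open>\<i>\<close>, and for \<open>z = T\<^sub>g \<i>\<close> it is the trace of \<open>g g\<^sup>T\<close>.\<close>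

definition hvec_trace :: "complex \<Rightarrow> real" where
  "hvec_trace z = hvec z $ 1 + hvec z $ 3"

text \<open>A point within bounded distance of \<open>p\<close> is within bounded distance of \<open>\<i>\<close>.\<close>

lemma hvec_trace_bound:
  assumes "0 < Im p" "0 < Im z" "polar (hvec z) (hvec p) \<le> r"
  shows "hvec_trace z \<le> r * (2 * Im p + (2 * (Re p)\<^sup>2 + 1) / Im p)"
proof -
  have 1: "(Re z - Re p)\<^sup>2 + (Im z)\<^sup>2 + (Im p)\<^sup>2 \<le> r * (Im z * Im p)"
    using assms unfolding polar_hvec[OF assms(2,1)] by (simp add: pos_divide_le_eq)
  have "(Im p)\<^sup>2 \<le> r * (Im z * Im p)"
    using 1 zero_le_power2[of "Re z - Re p"] zero_le_power2[of "Im z"] by linarith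
  then have "Im p * Im p \<le> (r * Im z) * Im p" by (simp add: power2_eq_square)
  then have "Im p \<le> r * Im z" using assms(1) by simp
  then have 2: "1 \<le> (r / Im p) * Im z" using assms(1) by (simp add: field_simps)
  have "0 \<le> (Re z - 2 * Re p)\<^sup>2" by simp
  then have sq: "(Re z)\<^sup>2 \<le> 2 * (Re z - Re p)\<^sup>2 + 2 * (Re p)\<^sup>2"
    by (simp add: power2_eq_square algebra_simps)
  have "a + b + 1 \<le> 2 * (c + b + d) + (2 * e + 1) * 1" if "a \<le> 2 * c + 2 * e" "0 \<le> b" "0 \<le> d"
    for a b c d e :: real
    using that by (simp add: distrib_left)
  from this[OF sq, of "(Im z)\<^sup>2" "(Im p)\<^sup>2"]
  have "(Re z)\<^sup>2 + (Im z)\<^sup>2 + 1 \<le> 2 * ((Re z - Re p)\<^sup>2 + (Im z)\<^sup>2 + (Im p)\<^sup>2) + (2 * (Re p)\<^sup>2 + 1) * 1"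
    by simp
  also have "\<dots> \<le> 2 * (r * (Im z * Im p)) + (2 * (Re p)\<^sup>2 + 1) * ((r / Im p) * Im z)"
    using 1 2 by (intro add_mono mult_left_mono) auto
  also have "\<dots> = (r * (2 * Im p + (2 * (Re p)\<^sup>2 + 1) / Im p)) * Im z"
    using assms(1) by (simp add: field_simps)
  finally show ?thesis
    using assms(2) by (simp add: hvec_trace_def pos_divide_le_eq flip: add_divide_distrib)
qed

definition frob_sq :: "real^2^2 \<Rightarrow> real" where
  "frob_sq g = (g$1$1)\<^sup>2 + (g$1$2)\<^sup>2 + (g$2$1)\<^sup>2 + (g$2$2)\<^sup>2"

lemma hvec_trace_mob_ii: "det g = 1 \<Longrightarrow> hvec_trace (mob g \<i>) = frob_sq g"
  using mob_hvec[of g \<i>] by (simp add: hvec_trace_def frob_sq_def)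

lemma compact_frob_sq: "compact {g. frob_sq g \<le> r}"
proof -
  have "norm g \<le> 4 * (r + 1)" if "frob_sq g \<le> r" for g
  proof -
    have e: "\<bar>g$i$j\<bar> \<le> r + 1" for i j
    proof -
      have "(g$i$j)\<^sup>2 \<le> frob_sq g"
        using exhaust_2[of i] exhaust_2[of j] by (auto simp: frob_sq_def)
      moreover have "\<bar>x\<bar> \<le> x\<^sup>2 + 1" for x :: real
        using zero_le_power2[of "\<bar>x\<bar> - 1"] by (simp add: power2_diff)
      ultimately show ?thesis using that by (meson add_right_mono order_trans)
    qed
    have "norm g \<le> (\<Sum>i\<in>UNIV. norm (g$i))" unfolding norm_vec_def by (rule L2_set_le_sum) simp
    also have "\<dots> \<le> (\<Sum>i\<in>UNIV. \<Sum>j\<in>UNIV. \<bar>g$i$j\<bar>)"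
      by (intro sum_mono norm_le_l1_cart)
    also have "\<dots> \<le> 4 * (r + 1)"
      using e[of 1 1] e[of 1 2] e[of 2 1] e[of 2 2] by (simp add: sum_2)
    finally show ?thesis .
  qed
  then have "bounded {g. frob_sq g \<le> r}" unfolding bounded_iff by blast
  moreover have "closed {g. frob_sq g \<le> r}"
    unfolding frob_sq_def by (intro closed_Collect_le continuous_intros)
  ultimately show ?thesis by (simp add: compact_eq_bounded_closed)
qed

lemma mob_transitive:
  assumes "0 < Im z"
  obtains h where "det h = 1" "mob h \<i> = z"
proof
  let ?h = "vector [vector [sqrt (Im z), Re z / sqrt (Im z)], vector [0, 1 / sqrt (Im z)]] :: real^2^2"
  show "det ?h = 1" using assms by (simp add: det_2)
  show "mob ?h \<i> = z" using assms by (simp add: mob_def complex_eq_iff)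
qed

text \<open>Fixing \<open>\<i>\<close> gives \<open>a = d\<close> and \<open>b = - c\<close>, and fixing \<open>2 \<i>\<close> gives \<open>b = - 4 c\<close>.\<close>

lemma mob_trivial:
  assumes "det g = 1" "mob g \<i> = \<i>" "mob g (2 * \<i>) = 2 * \<i>"
  shows "g = mat 1 \<or> g = - mat 1"
proof -
  have "of_real (g$1$1) * \<i> + of_real (g$1$2) = \<i> * (of_real (g$2$1) * \<i> + of_real (g$2$2))"
    using mob_denominator[OF assms(1), of \<i>] assms(2) by (simp add: mob_def divide_simps)
  then have 1: "g$1$1 = g$2$2" "g$1$2 = - g$2$1" by (simp_all add: complex_eq_iff)
  have "of_real (g$1$1) * (2 * \<i>) + of_real (g$1$2) = (2 * \<i>) * (of_real (g$2$1) * (2 * \<i>) + of_real (g$2$2))"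
    using mob_denominator[OF assms(1), of "2 * \<i>"] assms(3) by (simp add: mob_def divide_simps)
  then have "g$1$2 = - 4 * g$2$1" by (simp add: complex_eq_iff)
  then have 2: "g$2$1 = 0" "g$1$2 = 0" using 1 by simp_all
  then have "(g$2$2)\<^sup>2 = 1" using assms(1) 1 by (simp add: det_2 power2_eq_square)
  then have "g$2$2 = 1 \<or> g$2$2 = -1" by (simp add: power2_eq_1_iff)
  then show ?thesis using 1 2 by (auto simp: vec_eq_iff forall_2 mat_def)
qed

section \<open>Triangle groups\<close>

text \<open>A triangle with vertices \<open>p i\<close>, where \<open>w i\<close> is the functional of the side opposite to \<open>p i\<close>,
  and the sides \<open>i\<close> and \<open>j\<close> meet at the angle \<open>\<pi> / m i j\<close>.\<close>

locale triangle_reflections =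
  fixes p :: "3 \<Rightarrow> complex" and w :: "3 \<Rightarrow> real^3" and m :: "3 \<Rightarrow> 3 \<Rightarrow> nat"
  assumes Im_p: "0 < Im (p i)"
    and unit: "lorentz (w i) (w i) = 1"
    and level_off: "i \<noteq> j \<Longrightarrow> level (w i) (p j) = 0"
    and level_pos: "0 < level (w i) (p i)"
    and angle: "i \<noteq> j \<Longrightarrow> lorentz (w i) (w j) = - cos (pi / m i j)"
    and m_symmetric: "m i j = m j i"
    and m_ge_two: "i \<noteq> j \<Longrightarrow> 2 \<le> m i j"
begin

sublocale coxeter_matrix m
  by unfold_locales (use m_symmetric m_ge_two in auto)

abbreviation B where "B \<equiv> BijGroup \<H>"

sublocale B: group B by (rule group_BijGroup)

definition levels :: "complex \<Rightarrow> 3 \<Rightarrow> real" where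
  "levels z = (\<lambda>i. level (w i) z)"

definition R :: "3 \<Rightarrow> complex \<Rightarrow> complex" where
  "R i = restrict (mirror_map (w i)) \<H>"

definition word :: "3 list \<Rightarrow> complex \<Rightarrow> complex" where
  "word ws = foldr (\<otimes>\<^bsub>B\<^esub>) (map R ws) \<one>\<^bsub>B\<^esub>"

lemma R_in: "R i \<in> carrier B"
  unfolding R_def by (rule mirror_map_in_BijGroup[OF unit])

lemma word_simps: "word [] = \<one>\<^bsub>B\<^esub>" "word (i # ws) = R i \<otimes>\<^bsub>B\<^esub> word ws"
  by (simp_all add: word_def)

lemma word_in: "word ws \<in> carrier B"
  by (induction ws) (use R_in in \<open>auto simp: word_simps\<close>)

lemma word_append: "word (us @ vs) = word us \<otimes>\<^bsub>B\<^esub> word vs"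
  by (induction us) (use R_in word_in in \<open>auto simp: word_simps B.m_assoc\<close>)

lemma R_R: "R i \<otimes>\<^bsub>B\<^esub> R i = \<one>\<^bsub>B\<^esub>"
proof (rule BijGroup_eqI)
  fix z assume "z \<in> \<H>"
  then show "(R i \<otimes>\<^bsub>B\<^esub> R i) z = \<one>\<^bsub>B\<^esub> z"
    using BijGroup_mult[OF R_in R_in, of z] Im_mirror_map_pos[OF unit] mirror_map_involution[OF unit]
    by (simp add: BijGroup_one R_def)
qed (use R_in in auto)

lemma word_rev: "word (rev ws) \<otimes>\<^bsub>B\<^esub> word ws = \<one>\<^bsub>B\<^esub>"
proof (induction ws)
  case (Cons i ws)
  have "word (rev (i # ws)) \<otimes>\<^bsub>B\<^esub> word (i # ws) = word (rev ws) \<otimes>\<^bsub>B\<^esub> (R i \<otimes>\<^bsub>B\<^esub> R i) \<otimes>\<^bsub>B\<^esub> word ws"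
    using R_in word_in by (simp add: word_append word_simps B.m_assoc)
  then show ?case using Cons R_R word_in by simp
qed (simp add: word_simps)

lemma word_\<H>: "0 < Im z \<Longrightarrow> 0 < Im (word ws z)"
  using BijGroup_maps[OF word_in, of z ws] by simp

lemma word_Cons_apply: "0 < Im z \<Longrightarrow> word (i # ws) z = mirror_map (w i) (word ws z)"
  using BijGroup_mult[OF R_in word_in, of z i ws] word_\<H>[of z ws] by (simp add: word_simps R_def)

lemma word_append_apply: "0 < Im z \<Longrightarrow> word (us @ vs) z = word us (word vs z)"
  unfolding word_append by (rule BijGroup_mult[OF word_in word_in]) simp

text \<open>The levels turn the reflections of the plane into those of the geometric representation,
  because the angle condition is the entry \<open>- cos (\<pi> / m i j)\<close> of the Coxeter form.\<close>

lemma levels_mirror_map: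
  assumes "0 < Im z"
  shows "levels (mirror_map (w i) z) = coxeter_reflection m i (levels z)"
  unfolding levels_def level_mirror_map[OF unit assms] coxeter_reflection_def
  by (auto simp: fun_eq_iff unit angle)

lemma levels_word: "0 < Im z \<Longrightarrow> levels (word ws z) = act ws (levels z)"
proof (induction ws)
  case Nil
  then show ?case by (simp add: word_simps BijGroup_one)
next
  case (Cons i ws)
  then show ?case using word_\<H>[of z ws] by (simp add: word_Cons_apply levels_mirror_map)
qed

text \<open>The matrix of the functionals times the matrix of the vertices is diagonal with positive
  entries, so the vertices are the dual basis up to scaling.\<close>

lemma barycentric: "hvec z = (\<Sum>j\<in>UNIV. (levels z j / levels (p j) j) *\<^sub>R hvec (p j))"
proof -
  define M where "M = (\<chi> i. w i)"
  define N where "N = (\<chi> a j. hvec (p j) $ a / levels (p j) j)"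
  have "M ** N = mat 1"
  proof -
    have "(M ** N) $ i $ j = level (w i) (p j) / levels (p j) j" for i j
      by (simp add: M_def N_def matrix_matrix_mult_def inner_vec_def sum_divide_distrib)
    moreover have "level (w i) (p j) / levels (p j) j = (if i = j then 1 else 0)" for i j
      using level_off[of i j] level_pos[of j] by (cases "i = j") (auto simp: levels_def)
    ultimately show ?thesis by (simp add: vec_eq_iff mat_def)
  qed
  then have "N ** M = mat 1" by (simp add: matrix_left_right_inverse)
  then have "hvec z = N *v (M *v hvec z)" by (simp add: matrix_vector_mul_assoc)
  moreover have "M *v hvec z = (\<chi> i. levels z i)"
    by (simp add: M_def levels_def matrix_vector_mult_def vec_eq_iff inner_vec_def)
  ultimately have *: "hvec z = N *v (\<chi> i. levels z i)" by simp
  show ?thesis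
    by (subst *) (simp add: vec_eq_iff N_def matrix_vector_mult_def algebra_simps)
qed

lemma levels_inject:
  assumes "0 < Im z" "0 < Im z'" "levels z = levels z'"
  shows "z = z'"
  using barycentric[of z] barycentric[of z'] assms hvec_inject by metis

lemma word_trivial:
  assumes "act ws = id"
  shows "word ws = \<one>\<^bsub>B\<^esub>"
proof (rule BijGroup_eqI)
  fix z assume z: "z \<in> \<H>"
  then have "levels (word ws z) = levels z" using levels_word[of z ws] assms by simp
  then show "word ws z = \<one>\<^bsub>B\<^esub> z" using z levels_inject[of "word ws z" z] word_\<H>[of z ws] by (simp add: BijGroup_one)
qed (auto intro: word_in)

lemma open_chamber_disjoint:
  assumes "0 < Im z" "\<And>i. 0 < levels z i" "\<And>i. 0 < levels (word ws z) i"
  shows "word ws = \<one>\<^bsub>B\<^esub>"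
proof (rule word_trivial, rule ccontr)
  assume "act ws \<noteq> id"
  then show False
  proof (rule chamber_disjoint)
    fix i assume "\<And>y. (\<And>j. 0 \<le> y j) \<Longrightarrow> act ws y i \<le> 0"
    then have "levels (word ws z) i \<le> 0" using assms(1,2) levels_word[of z ws] by (simp add: less_imp_le)
    then show False using assms(3)[of i] by simp
  qed
qed

definition centre :: "real^3" where
  "centre = hvec (p 1) + hvec (p 2) + hvec (p 3)"

text \<open>The sum of the vertices lies in the light cone, and all three functionals are positive on it.\<close>

lemma interior_point:
  "\<exists>z. 0 < Im z \<and> (\<forall>i. 0 < levels z i)"
proof -
  have "0 < centre $ 3"
    using Im_p[of 1] Im_p[of 2] Im_p[of 3] by (simp add: centre_def add_pos_pos)
  moreover have "0 < polar (hvec (p i)) (hvec (p j))" for i j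
    using polar_hvec_ge_2[OF Im_p Im_p, of i j] by simp
  then have "0 < polar centre centre" by (simp add: centre_def polar_add add_pos_pos)
  ultimately obtain z k where z: "0 < Im z" "0 < k" "hvec z = k *\<^sub>R centre" by (rule hvec_surj)
  have "0 < levels z i" for i
  proof -
    have "levels z i = k * (level (w i) (p 1) + level (w i) (p 2) + level (w i) (p 3))"
      unfolding levels_def z(3) centre_def by (simp add: inner_add_right)
    also have "level (w i) (p 1) + level (w i) (p 2) + level (w i) (p 3) = level (w i) (p i)"
      using exhaust_3[of i] level_off[of i] by auto
    finally show ?thesis using z(2) level_pos[of i] by simp
  qed
  then show ?thesis using z by blast
qed

text \<open>With nonnegative coefficients \<open>a\<close>, all terms of \<open>2 = polar (hvec z) (hvec z) = \<Sum> a j a k polar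
  (hvec (p j)) (hvec (p k))\<close> are nonnegative, and the term \<open>j = k = i\<close> is \<open>2 (a i)\<^sup>2\<close>.\<close>

lemma chamber_coefficient_le_1:
  assumes "0 < Im z" "\<And>i. 0 \<le> levels z i"
  shows "levels z i / levels (p i) i \<le> 1"
proof -
  define a where "a j = levels z j / levels (p j) j" for j
  have a: "0 \<le> a j" for j using assms(2)[of j] level_pos[of j] by (simp add: a_def levels_def)
  have z: "hvec z = (\<Sum>j\<in>UNIV. a j *\<^sub>R hvec (p j))" unfolding a_def by (rule barycentric)
  have P: "2 \<le> polar (hvec (p j)) (hvec (p k))" for j k using polar_hvec_ge_2[OF Im_p Im_p] .
  have PP: "0 \<le> a j * (a k * polar (hvec (p j)) (hvec (p k)))" for j k using a[of j] a[of k] P[of j k] by simp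
  have "2 = polar (hvec z) (hvec z)" using hvec_det[OF assms(1)] by (simp add: polar_self del: hvec_nth)
  also have "\<dots> = (\<Sum>j\<in>UNIV. \<Sum>k\<in>UNIV. a j * (a k * polar (hvec (p j)) (hvec (p k))))"
    unfolding z sum_3 by (simp add: polar_add polar_scale algebra_simps)
  also have "\<dots> \<ge> (\<Sum>k\<in>UNIV. a i * (a k * polar (hvec (p i)) (hvec (p k))))"
    by (rule member_le_sum) (auto intro!: sum_nonneg PP)
  also have "(\<Sum>k\<in>UNIV. a i * (a k * polar (hvec (p i)) (hvec (p k)))) \<ge> a i * (a i * polar (hvec (p i)) (hvec (p i)))"
    by (rule member_le_sum) (auto intro!: PP)
  finally have "a i * (a i * polar (hvec (p i)) (hvec (p i))) \<le> 2" by simp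
  moreover have "polar (hvec (p i)) (hvec (p i)) = 2"
    using hvec_det[OF Im_p[of i]] by (simp add: polar_self del: hvec_nth)
  ultimately have "(a i)\<^sup>2 \<le> 1\<^sup>2" by (simp add: power2_eq_square)
  then have "a i \<le> 1" by (rule power2_le_imp_le) simp
  then show ?thesis by (simp add: a_def)
qed

lemma chamber_hvec_trace:
  assumes "0 < Im z" "\<And>i. 0 \<le> levels z i"
  shows "hvec_trace z \<le> (\<Sum>j\<in>UNIV. hvec_trace (p j))"
proof -
  have "hvec_trace z = (\<Sum>j\<in>UNIV. (levels z j / levels (p j) j) * hvec_trace (p j))"
    unfolding hvec_trace_def by (subst (1 2) barycentric) (simp add: sum_distrib_left sum.distrib algebra_simps del: hvec_nth)
  also have "\<dots> \<le> (\<Sum>j\<in>UNIV. 1 * hvec_trace (p j))"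
    using chamber_coefficient_le_1[OF assms] Im_p
    by (intro sum_mono mult_right_mono) (auto simp: hvec_trace_def less_imp_le)
  finally show ?thesis by simp
qed

text \<open>Twice the sum of the hyperbolic cosines of the distances to the vertices.\<close>

definition dist_sum :: "complex \<Rightarrow> real" where
  "dist_sum z = polar (hvec z) centre"

text \<open>Two vertices lie on the wall \<open>i\<close>, so only the distance to the opposite vertex changes. It
  decreases if \<open>z\<close> is on the negative side of the wall.\<close>

lemma dist_sum_mirror_map:
  assumes "0 < Im z"
  shows "dist_sum (mirror_map (w i) z) = dist_sum z + 4 * levels z i * level (w i) (p i)"
proof -
  have *: "polar (vector [- 2 * w i $ 3, w i $ 2, - 2 * w i $ 1]) v = - 2 * (w i \<bullet> v)" for v
    by (simp add: polar_def inner_vec_def sum_3)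
  have "w i \<bullet> centre = level (w i) (p 1) + level (w i) (p 2) + level (w i) (p 3)"
    by (simp add: centre_def inner_add_right)
  also have "\<dots> = level (w i) (p i)"
    using exhaust_3[of i] level_off[of i] by auto
  finally show ?thesis
    unfolding dist_sum_def hvec_mirror_map[OF unit assms] polar_minus polar_scale * levels_def by simp
qed

lemma dist_sum_ge:
  assumes "0 < Im z"
  shows "polar (hvec z) (hvec (p 1)) \<le> dist_sum z"
  using polar_hvec_ge_2[OF assms Im_p, of 2] polar_hvec_ge_2[OF assms Im_p, of 3]
  by (simp add: dist_sum_def centre_def polar_add)

definition \<Gamma> :: "(real^2^2) set" where
  "\<Gamma> = {g. det g = 1 \<and> (\<exists>ws. even (length ws) \<and> moebius_transf g = word ws)}"

text \<open>Two consecutive reflections compose to a Moebius transformation.\<close>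

lemma even_word_moebius:
  assumes "even (length ws)"
  obtains g where "g \<in> \<Gamma>" "moebius_transf g = word ws"
proof -
  have "even (length ws) \<longrightarrow> (\<exists>g. det g = 1 \<and> moebius_transf g = word ws)"
  proof (induction ws rule: induct_list012)
    case 1
    show ?case by (auto simp: word_simps moebius_transf_one intro!: exI[of _ "mat 1"])
  next
    case (3 i j ws)
    show ?case
    proof
      assume "even (length (i # j # ws))"
      then obtain g where g: "det g = 1" "moebius_transf g = word ws" using 3 by auto
      obtain h where h: "det h = 1" "\<And>z. 0 < Im z \<Longrightarrow> mob h z = mirror_map (w i) (mirror_map (w j) z)"
        using mirror_map_mirror_map_mob[OF unit unit, of i j] by blast
      have "moebius_transf h = R i \<otimes>\<^bsub>B\<^esub> R j"
      proof (rule BijGroup_eqI)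
        fix z assume z: "z \<in> \<H>"
        then show "moebius_transf h z = (R i \<otimes>\<^bsub>B\<^esub> R j) z"
          using BijGroup_mult[OF R_in R_in z, of i j] h(2)[of z] Im_mirror_map_pos[OF unit, of z j]
          by (simp add: moebius_transf_mob R_def)
      qed (use R_in h moebius_transf_in_BijGroup in auto)
      then have "moebius_transf (h ** g) = word (i # j # ws)"
        using g h R_in word_in by (simp add: moebius_transf_mult word_simps B.m_assoc)
      moreover have "det (h ** g) = 1" using g h by (simp add: det_mul)
      ultimately show "\<exists>g. det g = 1 \<and> moebius_transf g = word (i # j # ws)" by blast
    qed
  qed simp
  then show ?thesis using assms that by (auto simp: \<Gamma>_def)
qed

lemma subgroup_\<Gamma>: "subgroup \<Gamma> SL2R"
proof (rule subgroup.intro)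
  show "\<Gamma> \<subseteq> carrier SL2R" by (auto simp: \<Gamma>_def carrier_SL2R)
  show "\<one>\<^bsub>SL2R\<^esub> \<in> \<Gamma>"
    by (auto simp: \<Gamma>_def one_SL2R moebius_transf_one word_simps intro!: exI[of _ "[]"])
next
  fix g h assume "g \<in> \<Gamma>" "h \<in> \<Gamma>"
  then obtain us vs where *: "det g = 1" "det h = 1" "even (length us)" "even (length vs)"
    "moebius_transf g = word us" "moebius_transf h = word vs" by (auto simp: \<Gamma>_def)
  then have "moebius_transf (g ** h) = word (us @ vs)" by (simp add: moebius_transf_mult word_append)
  then show "g \<otimes>\<^bsub>SL2R\<^esub> h \<in> \<Gamma>"
    using * by (auto simp: \<Gamma>_def mult_SL2R det_mul intro!: exI[of _ "us @ vs"])
next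
  fix g assume "g \<in> \<Gamma>"
  then obtain ws where *: "det g = 1" "even (length ws)" "moebius_transf g = word ws" by (auto simp: \<Gamma>_def)
  have "moebius_transf (adj2 g) \<otimes>\<^bsub>B\<^esub> word ws = \<one>\<^bsub>B\<^esub>"
    using moebius_transf_mult[of "adj2 g" g] * by (simp add: adj2_mult moebius_transf_one)
  moreover have "moebius_transf (adj2 g) \<in> carrier B" using * by (intro moebius_transf_in_BijGroup) simp
  ultimately have "moebius_transf (adj2 g) = word (rev ws)"
    using B.inv_equality[OF _ word_in] word_rev[of ws] word_in by metis
  then show "inv\<^bsub>SL2R\<^esub> g \<in> \<Gamma>"
    using * inv_SL2R[of g] by (auto simp: \<Gamma>_def carrier_SL2R intro!: exI[of _ "rev ws"])
qed

text \<open>The neighbourhood \<open>V\<close> consists of the matrices of positive trace that keep an interior point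
  inside the triangle. The second condition leaves only matrices acting trivially, and the trace
  excludes the negative of the identity.\<close>

lemma discrete_\<Gamma>: "\<exists>V. discrete_SL2R_subgroup \<Gamma> V"
proof -
  obtain z where z: "0 < Im z" "\<And>i. 0 < levels z i" using interior_point by blast
  \<comment> \<open>\<open>q i\<close> is the level of the image of \<open>z\<close> for determinant \<open>1\<close>, written as a polynomial in
    \<open>g\<close> so that it is continuous on all matrices.\<close>
  define q where "q i g = w i $ 1 * (((g$1$1 * Re z + g$1$2)\<^sup>2 + (g$1$1 * Im z)\<^sup>2) / Im z)
     + w i $ 2 * (((g$1$1 * g$2$1) * ((Re z)\<^sup>2 + (Im z)\<^sup>2) + (g$1$1 * g$2$2 + g$1$2 * g$2$1) * Re z + g$1$2 * g$2$2) / Im z)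
     + w i $ 3 * (((g$2$1 * Re z + g$2$2)\<^sup>2 + (g$2$1 * Im z)\<^sup>2) / Im z)" for i and g :: "real^2^2"
  have q: "levels (mob g z) i = q i g" if "det g = 1" for g i
    using mob_hvec(2-4)[OF that z(1)]
    by (simp add: levels_def q_def inner_vec_def sum_3 geodesic_poly_def del: hvec_nth)
  have cont: "continuous_on UNIV (q i)" for i
    unfolding q_def using z(1) by (intro continuous_intros) auto
  define V where "V = (\<Inter>i. {g. 0 < q i g}) \<inter> {g. 0 < g$1$1 + g$2$2}"
  have "open V"
    unfolding V_def by (intro open_Int open_INT ballI open_Collect_less cont continuous_intros) auto
  moreover have "mat 1 \<in> V"
    using q[of "mat 1"] z(2) by (simp add: V_def mob_one) (simp add: mat_def)
  moreover have "V \<inter> \<Gamma> \<subseteq> {mat 1}"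
  proof
    fix g assume "g \<in> V \<inter> \<Gamma>"
    then obtain ws where g: "\<And>i. 0 < q i g" "0 < g$1$1 + g$2$2" "det g = 1" "moebius_transf g = word ws"
      by (auto simp: V_def \<Gamma>_def)
    have wz: "word ws z' = mob g z'" if "0 < Im z'" for z'
      unfolding g(4)[symmetric] using that by (simp add: moebius_transf_mob)
    have "word ws = \<one>\<^bsub>B\<^esub>"
      using g(1) q[OF g(3)] wz[OF z(1)] by (intro open_chamber_disjoint[OF z]) simp
    then have "mob g z' = z'" if "0 < Im z'" for z'
      using wz[OF that] that by (simp add: BijGroup_one)
    then have "g = mat 1 \<or> g = - mat 1" using g(3) by (intro mob_trivial) auto
    moreover have "g \<noteq> - mat 1"
    proof
      assume "g = - mat 1"
      then show False using g(2) by (simp add: mat_def)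
    qed
    ultimately show "g \<in> {mat 1}" by simp
  qed
  ultimately show ?thesis using subgroup_\<Gamma> by (auto simp: discrete_SL2R_subgroup_def)
qed

text \<open>Writing \<open>z = T\<^sub>h \<i>\<close>, a bound on the distance sum of \<open>T\<^sub>\<gamma> z\<close> bounds the entries of \<open>\<gamma> h\<close> and
  hence those of \<open>\<gamma>\<close>. Only finitely many elements of the discrete group \<open>\<Gamma>\<close> remain.\<close>

lemma finite_even_orbit:
  assumes "0 < Im z"
  shows "finite {word ws z | ws. even (length ws) \<and> dist_sum (word ws z) \<le> r}"
proof -
  obtain V where "discrete_SL2R_subgroup \<Gamma> V" using discrete_\<Gamma> by blast
  then interpret discrete_SL2R_subgroup \<Gamma> V .
  obtain h where h: "det h = 1" "mob h \<i> = z" using mob_transitive[OF assms] .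
  define C where "C = r * (2 * Im (p 1) + (2 * (Re (p 1))\<^sup>2 + 1) / Im (p 1))"
  let ?S = "{\<gamma> \<in> \<Gamma>. frob_sq (\<gamma> ** h) \<le> C}"
  have "?S \<subseteq> (\<lambda>x. x ** adj2 h) ` {x. frob_sq x \<le> C}"
  proof
    fix \<gamma> assume "\<gamma> \<in> ?S"
    then show "\<gamma> \<in> (\<lambda>x. x ** adj2 h) ` {x. frob_sq x \<le> C}"
      using h by (intro image_eqI[of _ _ "\<gamma> ** h"]) (auto simp: adj2_mult simp flip: matrix_mul_assoc)
  qed
  moreover have "compact ((\<lambda>x. x ** adj2 h) ` {x. frob_sq x \<le> C})"
    by (intro compact_continuous_image compact_frob_sq continuous_intros)
  ultimately have "bounded ?S" using bounded_subset compact_imp_bounded by blast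
  then have "finite ?S" by (intro bounded_subset_finite) auto
  moreover have "{word ws z | ws. even (length ws) \<and> dist_sum (word ws z) \<le> r} \<subseteq> (\<lambda>\<gamma>. moebius_transf \<gamma> z) ` ?S"
  proof
    fix y assume "y \<in> {word ws z | ws. even (length ws) \<and> dist_sum (word ws z) \<le> r}"
    then obtain ws where ws: "y = word ws z" "even (length ws)" "dist_sum y \<le> r" by blast
    obtain \<gamma> where \<gamma>: "\<gamma> \<in> \<Gamma>" "moebius_transf \<gamma> = word ws" using even_word_moebius[OF ws(2)] .
    have "det \<gamma> = 1" using \<gamma> by (simp add: \<Gamma>_def)
    have y: "0 < Im y" using ws word_\<H>[OF assms] by simp
    have "mob (\<gamma> ** h) \<i> = y"
      using \<open>det \<gamma> = 1\<close> h ws(1) \<gamma>(2)[symmetric] assms by (simp add: mob_mult moebius_transf_mob)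
    then have "frob_sq (\<gamma> ** h) = hvec_trace y" using hvec_trace_mob_ii[of "\<gamma> ** h"] h \<open>det \<gamma> = 1\<close> by (simp add: det_mul)
    also have "\<dots> \<le> C"
      unfolding C_def using dist_sum_ge[OF y] ws(3) by (intro hvec_trace_bound[OF Im_p y]) simp
    finally have "frob_sq (\<gamma> ** h) \<le> C" .
    then show "y \<in> (\<lambda>\<gamma>. moebius_transf \<gamma> z) ` ?S" using \<gamma> ws(1) \<open>frob_sq (\<gamma> ** h) \<le> C\<close> by (intro image_eqI[of _ _ \<gamma>]) simp_all
  qed
  ultimately show ?thesis using finite_surj by blast
qed

text \<open>A point of the orbit with minimal distance sum lies in the closed triangle, since otherwise a
  reflection would decrease the sum. The minimum exists because only finitely many points of the
  orbit have a distance sum not above that of \<open>z\<close>: words of odd length are words of even length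
  applied to a reflected point.\<close>

lemma chamber_covers:
  assumes "0 < Im z"
  shows "\<exists>ws. \<forall>i. 0 \<le> levels (word ws z) i"
proof -
  define S where "S = {word ws z | ws. dist_sum (word ws z) \<le> dist_sum z}"
  let ?z' = "mirror_map (w 1) z"
  have z': "0 < Im ?z'" using Im_mirror_map_pos[OF unit assms] .
  have "S \<subseteq> {word ws z | ws. even (length ws) \<and> dist_sum (word ws z) \<le> dist_sum z} \<union>
    {word ws ?z' | ws. even (length ws) \<and> dist_sum (word ws ?z') \<le> dist_sum z}"
  proof
    fix y assume "y \<in> S"
    then obtain ws where ws: "y = word ws z" "dist_sum (word ws z) \<le> dist_sum z" by (auto simp: S_def)
    have "word (ws @ [1]) ?z' = word ws z"
      using word_append_apply[OF z', of ws "[1]"] word_Cons_apply[OF z', of 1 "[]"] mirror_map_involution[OF unit assms]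
      using z' by (simp add: word_simps BijGroup_one)
    then show "y \<in> {word ws z | ws. even (length ws) \<and> dist_sum (word ws z) \<le> dist_sum z} \<union>
      {word ws ?z' | ws. even (length ws) \<and> dist_sum (word ws ?z') \<le> dist_sum z}"
    proof (cases "even (length ws)")
      case False
      then have "even (length (ws @ [1]))" by simp
      then show ?thesis using ws \<open>word (ws @ [1]) ?z' = word ws z\<close> by (metis (mono_tags, lifting) UnI2 mem_Collect_eq)
    qed (use ws in blast)
  qed
  then have "finite S"
    using finite_even_orbit[OF assms] finite_even_orbit[OF z'] by (meson finite_UnI finite_subset)
  moreover have "z \<in> S"
    using assms by (auto simp: S_def word_simps BijGroup_one intro!: exI[of _ "[]"])
  ultimately obtain y where y: "y \<in> S" "\<And>x. x \<in> S \<Longrightarrow> dist_sum y \<le> dist_sum x"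
    using ex_min_if_finite[of "dist_sum ` S"] by (metis (no_types, lifting) arg_min_if_finite(1,2) empty_iff linorder_not_less)
  obtain ws where ws: "y = word ws z" "dist_sum y \<le> dist_sum z" using y(1) by (auto simp: S_def)
  have "0 \<le> levels y i" for i
  proof (rule ccontr)
    assume "\<not> 0 \<le> levels y i"
    then have neg: "levels y i * level (w i) (p i) < 0" using level_pos[of i] by (simp add: mult_neg_pos)
    have "0 < Im y" using ws word_\<H>[OF assms] by simp
    then have "dist_sum (mirror_map (w i) y) < dist_sum y" using neg by (simp add: dist_sum_mirror_map)
    moreover have "mirror_map (w i) y = word (i # ws) z" using ws word_Cons_apply[OF assms] by simp
    ultimately have "mirror_map (w i) y \<in> S" using ws(2) by (auto simp: S_def intro!: exI[of _ "i # ws"])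
    then show False using y(2) \<open>dist_sum (mirror_map (w i) y) < dist_sum y\<close> by fastforce
  qed
  then show ?thesis using ws(1) by blast
qed

lemma hvec_trace_mirror_map:
  assumes "0 < Im y"
  shows "hvec_trace (mirror_map (w i) y) = hvec_trace y + 4 * levels y i * (w i $ 1 + w i $ 3)"
  unfolding hvec_trace_def hvec_mirror_map[OF unit assms] by (simp add: levels_def algebra_simps del: hvec_nth)

text \<open>If the word that moves a point into the triangle has odd length, one more reflection makes it
  even. This only enlarges the triangle by its mirror image, which is still bounded.\<close>

theorem cocompact_lattice_\<Gamma>:
  "lattice_subgroup SL2R SL2R_top \<Gamma> \<and> cocompact SL2R SL2R_top \<Gamma>"
proof -
  obtain V where V: "discrete_SL2R_subgroup \<Gamma> V" using discrete_\<Gamma> by blast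
  define C where "C = (\<Sum>j\<in>UNIV. hvec_trace (p j)) + 4 * (level (w 1) (p 1) * \<bar>w 1 $ 1 + w 1 $ 3\<bar>)"
  have extra: "0 \<le> 4 * (level (w 1) (p 1) * \<bar>w 1 $ 1 + w 1 $ 3\<bar>)" using level_pos[of 1] by simp
  define K where "K = {g. frob_sq g \<le> C} \<inter> {g. det g = 1}"
  have "uniform_SL2R_subgroup \<Gamma> V K"
  proof (intro uniform_SL2R_subgroup.intro V uniform_SL2R_subgroup_axioms.intro)
    show "compact K" unfolding K_def by (intro compact_Int_closed compact_frob_sq closed_SL2)
    show "K \<subseteq> {g. det g = 1}" by (auto simp: K_def)
    fix g :: "real^2^2" assume g: "det g = 1"
    define z where "z = mob g \<i>"
    have z: "0 < Im z" using mob_hvec(1)[OF g] by (simp add: z_def)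
    obtain ws where ws: "\<And>i. 0 \<le> levels (word ws z) i" using chamber_covers[OF z] by blast
    define y where "y = word ws z"
    have y: "0 < Im y" using word_\<H>[OF z] by (simp add: y_def)
    have sy: "hvec_trace y \<le> (\<Sum>j\<in>UNIV. hvec_trace (p j))" using chamber_hvec_trace[OF y] ws by (simp add: y_def)
    have "\<exists>vs. even (length vs) \<and> hvec_trace (word vs z) \<le> C"
    proof (cases "even (length ws)")
      case True
      then show ?thesis using sy extra by (intro exI[of _ ws]) (simp add: C_def y_def)
    next
      case False
      have l: "0 \<le> levels y 1" "levels y 1 \<le> level (w 1) (p 1)"
        using ws[of 1] chamber_coefficient_le_1[OF y, of 1] ws level_pos[of 1]
        by (simp_all add: y_def levels_def)
      have "levels y 1 * (w 1 $ 1 + w 1 $ 3) \<le> levels y 1 * \<bar>w 1 $ 1 + w 1 $ 3\<bar>"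
        using l by (intro mult_left_mono) auto
      also have "\<dots> \<le> level (w 1) (p 1) * \<bar>w 1 $ 1 + w 1 $ 3\<bar>"
        using l by (intro mult_right_mono) auto
      finally have "hvec_trace (mirror_map (w 1) y) \<le> C"
        unfolding hvec_trace_mirror_map[OF y] C_def using sy by simp
      moreover have "word (1 # ws) z = mirror_map (w 1) y" using word_Cons_apply[OF z] by (simp add: y_def)
      ultimately show ?thesis using False by (intro exI[of _ "1 # ws"]) simp
    qed
    then obtain vs where vs: "even (length vs)" "hvec_trace (word vs z) \<le> C" by blast
    obtain \<gamma> where \<gamma>: "\<gamma> \<in> \<Gamma>" "moebius_transf \<gamma> = word vs" using even_word_moebius[OF vs(1)] .
    then have d: "det \<gamma> = 1" by (simp add: \<Gamma>_def)
    have "mob (\<gamma> ** g) \<i> = word vs z"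
      using d g z \<gamma>(2)[symmetric] by (simp add: mob_mult moebius_transf_mob z_def)
    then have "frob_sq (\<gamma> ** g) \<le> C" using hvec_trace_mob_ii[of "\<gamma> ** g"] d g vs(2) by (simp add: det_mul)
    then show "\<exists>\<gamma>\<in>\<Gamma>. \<gamma> ** g \<in> K" using \<gamma>(1) d g by (auto simp: K_def det_mul)
  qed
  then show ?thesis by (rule uniform_SL2R_subgroup.cocompact_lattice)
qed

end

text \<open>It remains to choose the functionals of the sides with the right signs and to match the
  reflections and the even products with the words of the triangle group.\<close>

theorem theorem5p6:
  fixes n1 n2 n3 :: nat
    and p1 p2 p3 :: complex
    and R1 R2 R3 :: "complex \<Rightarrow> complex"
    and \<Lambda> \<Lambda>0 :: "(complex \<Rightarrow> complex) set"
    and \<Gamma> :: "(real^2^2) set"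
  assumes "n1 > 0" "n2 > 0" "n3 > 0"
    and "pi / real n1 + pi / real n2 + pi / real n3 < pi"
    and "geodesic_triangle p1 p2 p3"
    and "hyp_angle p2 p1 p3 = pi / real n1"
    and "hyp_angle p3 p2 p1 = pi / real n2"
    and "hyp_angle p1 p3 p2 = pi / real n3"
    and "R1 = reflection (geodesic_through p2 p3)"
    and "R2 = reflection (geodesic_through p3 p1)"
    and "R3 = reflection (geodesic_through p1 p2)"
    and "\<Lambda> = generate (BijGroup upper_half_plane) {R1, R2, R3}"
    and "\<Lambda>0 = \<Lambda> \<inter> even_products (BijGroup upper_half_plane) {R1, R2, R3}"
    and "\<Gamma> = {g \<in> carrier SL2R. moebius_transf g \<in> \<Lambda>0}"
  shows "lattice_subgroup SL2R SL2R_top \<Gamma> \<and> cocompact SL2R SL2R_top \<Gamma>"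
proof -
  have H: "0 < Im p1" "0 < Im p2" "0 < Im p3"
    and off: "\<And>l. l \<in> geodesics \<Longrightarrow> \<not> {p1, p2, p3} \<subseteq> l"
    using assms(5) by (auto simp: geodesic_triangle_def)
  have through: "\<exists>l\<in>geodesics. x \<in> l \<and> y \<in> l" if xy: "x \<noteq> y" "0 < Im x" "0 < Im y" for x y
  proof -
    obtain w where "lorentz w w = 1" "x \<in> mirror w" "y \<in> mirror w" using functional_exists[OF xy] .
    then show ?thesis using geodesic_iff_mirror by blast
  qed
  have "\<exists>l\<in>geodesics. x \<in> l" if "0 < Im x" for x
    using through[of x "x + \<i>"] that by auto
  then have "\<exists>l\<in>geodesics. x \<in> l \<and> y \<in> l" if "0 < Im x" "0 < Im y" for x y
    using through[of x y] that by (cases "x = y") auto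
  then have ne: "p1 \<noteq> p2" "p2 \<noteq> p3" "p3 \<noteq> p1"
    using off H by (metis empty_subsetI insert_subset)+
  have side: "\<exists>w. lorentz w w = 1 \<and> x \<in> mirror w \<and> y \<in> mirror w \<and> 0 < level w z"
    if xyz: "{x, y, z} = {p1, p2, p3}" "x \<noteq> y" "0 < Im x" "0 < Im y" "0 < Im z" for x y z
  proof -
    obtain w where w: "lorentz w w = 1" "x \<in> mirror w" "y \<in> mirror w" using functional_exists[OF xyz(2-4)] .
    have "mirror w \<in> geodesics" using w(1) geodesic_iff_mirror by blast
    then have "z \<notin> mirror w" using off[of "mirror w"] w(2,3) unfolding xyz(1)[symmetric] by blast
    then have "level w z \<noteq> 0" using xyz(5) by (simp add: mirror_def)
    then consider "0 < level w z" | "0 < level (- w) z" by (cases "0 < level w z") auto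
    then show ?thesis
    proof cases
      case 2
      have "lorentz (- w) (- w) = 1" using w(1) by (simp add: lorentz_def)
      moreover have "x \<in> mirror (- w)" "y \<in> mirror (- w)" using w(2,3) by (simp_all add: mirror_def)
      ultimately show ?thesis using 2 by blast
    qed (use w in blast)
  qed
  obtain w1 where w1: "lorentz w1 w1 = 1" "p2 \<in> mirror w1" "p3 \<in> mirror w1" "0 < level w1 p1"
    using side[of p2 p3 p1] ne H by auto
  obtain w2 where w2: "lorentz w2 w2 = 1" "p3 \<in> mirror w2" "p1 \<in> mirror w2" "0 < level w2 p2"
    using side[of p3 p1 p2] ne H by auto
  obtain w3 where w3: "lorentz w3 w3 = 1" "p1 \<in> mirror w3" "p2 \<in> mirror w3" "0 < level w3 p3"
    using side[of p1 p2 p3] ne H by auto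
  have on: "geodesic_poly u z = 0" if "z \<in> mirror u" for u z
    using that level_eq_0_iff[of z u] by (simp add: mirror_def)
  have gpos: "0 < geodesic_poly u z" if "0 < level u z" "0 < Im z" for u z
    using that level_pos_iff[of z u] by simp
  have sym: "lorentz u v = lorentz v u" for u v by (simp add: lorentz_def)
  have a1: "lorentz w2 w3 = - cos (pi / n1)"
    using hyp_angle_lorentz[of p1 p2 p3 w3 w2] H ne w2 w3 on gpos assms(6) sym[of w2 w3] by simp
  have a2: "lorentz w3 w1 = - cos (pi / n2)"
    using hyp_angle_lorentz[of p2 p3 p1 w1 w3] H ne w1 w3 on gpos assms(7) sym[of w1 w3] by simp
  have a3: "lorentz w1 w2 = - cos (pi / n3)"
    using hyp_angle_lorentz[of p3 p1 p2 w2 w1] H ne w1 w2 on gpos assms(8) sym[of w1 w2] by simp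
  have pos: "0 < pi / n1" "0 < pi / n2" "0 < pi / n3" using assms(1-3) by simp_all
  then have "n1 \<noteq> 1" "n2 \<noteq> 1" "n3 \<noteq> 1" using assms(4) by auto
  then have n: "2 \<le> n1" "2 \<le> n2" "2 \<le> n3" using assms(1-3) by auto
  define p :: "3 \<Rightarrow> complex" where "p i = (if i = 1 then p1 else if i = 2 then p2 else p3)" for i
  define w :: "3 \<Rightarrow> real^3" where "w i = (if i = 1 then w1 else if i = 2 then w2 else w3)" for i
  define m :: "3 \<Rightarrow> 3 \<Rightarrow> nat" where
    "m i j = (if i \<noteq> 1 \<and> j \<noteq> 1 then n1 else if i \<noteq> 2 \<and> j \<noteq> 2 then n2 else n3)" for i j
  have lev: "level u z = 0" if "z \<in> mirror u" for u z using that by (simp add: mirror_def)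
  interpret triangle_reflections p w m
  proof
    fix i j :: 3
    show "0 < Im (p i)" using H by (simp add: p_def)
    show "lorentz (w i) (w i) = 1" using w1 w2 w3 by (simp add: w_def)
    show "0 < level (w i) (p i)" using w1 w2 w3 by (simp add: w_def p_def)
    show "m i j = m j i" by (simp add: m_def)
    assume ij: "i \<noteq> j"
    show "level (w i) (p j) = 0"
      using ij exhaust_3[of i] exhaust_3[of j] w1 w2 w3 lev by (auto simp: w_def p_def)
    show "lorentz (w i) (w j) = - cos (pi / m i j)"
      using ij exhaust_3[of i] exhaust_3[of j] a1 a2 a3 sym[of w1 w2] sym[of w3 w1] sym[of w2 w3]
      by (auto simp: w_def m_def)
    show "2 \<le> m i j" using n by (simp add: m_def)
  qed
  have R: "R 1 = R1" "R 2 = R2" "R 3 = R3"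
    using reflection_mirror[OF w1(1-3) ne(2)] reflection_mirror[OF w2(1-3) ne(3)] reflection_mirror[OF w3(1-3) ne(1)]
    unfolding assms(9-11) geodesic_through_mirror[OF ne(2) w1(2,3,1)] geodesic_through_mirror[OF ne(3) w2(2,3,1)]
      geodesic_through_mirror[OF ne(1) w3(2,3,1)]
    by (simp_all add: R_def w_def)
  then have gens: "{R1, R2, R3} = range R" by (simp add: UNIV_3)
  have "\<Lambda>0 = {word ws | ws. even (length ws)}"
  proof -
    have "word ws \<in> generate B (range R)" for ws
      by (induction ws) (auto simp: word_simps intro: generate.intros)
    moreover have "even_products B (range R) = {word ws | ws. even (length ws)}"
    proof -
      have "(set xs \<subseteq> range R) = (\<exists>ws. xs = map R ws)" for xs
        unfolding ex_map_conv by blast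
      then show ?thesis unfolding even_products_def word_def by (auto intro: exI[of _ "map R _"])
    qed
    ultimately show ?thesis unfolding assms(12,13) gens by auto
  qed
  then have "\<Gamma> = triangle_reflections.\<Gamma> w"
    unfolding assms(14) \<Gamma>_def carrier_SL2R by auto
  then show ?thesis using cocompact_lattice_\<Gamma> by simp
qed

end
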